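(* For each $n\ge 1$ let $\theta_1=\theta_1^{(n)},\dots,\theta_n=\theta_n^{(n)}$ be positive real weights (allowed to depend on $n$), and set $f_n(y):=\theta_{\lfloor yn\rfloor}$ for $y\in[0,1]$. Assume that $f_n\to f$ almost everywhere on $[0,1]$ for some positive, finite, measurable function $f$ on $[0,1]$. Then for all $k\ge1$ and every $\pi\in\mathcal S_k$, $$\lim_{n\to+\infty}\frac1n\sum_{i=0}^{n-k}p\left(\theta_{i+\pi^{-1}(1)},\dots,\theta_{i+\pi^{-1}(k)}\right)=\frac1{k!},$$ and, writing $(\nu_n(\pi))^2:=\mathrm{Var}\left(\mathrm{c\text{-}occ}(\pi,\sigma_n)\right)$ with $\sigma_n\sim\mathrm{Luce}(\theta_1,\dots,\theta_n)$, $$\lim_{n\to\infty}\frac{(\nu_n(\pi))^2}{n}=\nu_\infty(\pi),\qquad \nu_\infty(\pi):=\frac1{k!}+\frac{1-2k}{(k!)^2}+2\sum_{h=1}^{k-1}\zeta_\pi(h,k),$$ where for $1\le h\le k-1$ $$\zeta_\pi(h,k):=\mathbb P\left(E_{\pi^{-1}(1)}<\dots<E_{\pi^{-1}(k)},\ E_{h+\pi^{-1}(1)}<\dots<E_{h+\pi^{-1}(k)}\right)$$ and $(E_j)_{j\ge1}$ are i.i.d. exponential random variables of parameter $1$.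
   Context: For positive reals $x_1,\dots,x_k$ with $w=x_1+\dots+x_k$, $$p(x_1,\dots,x_k):=\frac{x_1}{w}\cdot\frac{x_2}{w-x_1}\cdot\frac{x_3}{w-x_1-x_2}\cdots\frac{x_k}{x_k}.$$ $\mathcal S_n$ is the set of permutations of $[n]=\{1,\dots,n\}$. A random permutation $\sigma_n\in\mathcal S_n$ is $\mathrm{Luce}(\theta_1,\dots,\theta_n)$-distributed if $\mathbb P(\sigma_n=\sigma)=p(\theta_{\sigma^{-1}(1)},\dots,\theta_{\sigma^{-1}(n)})$ for all $\sigma\in\mathcal S_n$. For $\sigma\in\mathcal S_n$ and $I=\{i_1<\dots<i_k\}\subset[n]$, $\mathrm{pat}_I(\sigma)\in\mathcal S_k$ is the permutation with the same relative order as $\sigma(i_1),\dots,\sigma(i_k)$. For $\pi\in\mathcal S_k$, $\mathrm{c\text{-}occ}(\pi,\sigma):=\#\{I\subseteq[n]:\#I=k,\ I\text{ an interval of integers},\ \mathrm{pat}_I(\sigma)=\pi\}$. The value of $f_n$ on $[0,1/n)$, where $\lfloor yn\rfloor=0$, is irrelevant (e.g. set $\theta_0:=\theta_1$). *)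

theory Defs
  imports "HOL-Probability.Probability" "HOL-Combinatorics.Permutations"
begin

text \<open>
  Permutations of \<open>[n]\<close> are functions \<open>\<sigma> :: nat \<Rightarrow> nat\<close> with \<open>\<sigma> permutes {1..n}\<close>
  (so they are the identity outside \<open>{1..n}\<close>), and tuples \<open>(x\<^sub>1, \<dots>, x\<^sub>k)\<close> are
  functions on \<open>nat\<close> of which only the values at \<open>1, \<dots>, k\<close> matter.
\<close>

definition luce_p :: "nat \<Rightarrow> (nat \<Rightarrow> real) \<Rightarrow> real" where
  "luce_p k x = (\<Prod>j=1..k. x j / ((\<Sum>l=1..k. x l) - (\<Sum>l=1..<j. x l)))"

definition luce_distributed ::
    "'w measure \<Rightarrow> ('w \<Rightarrow> nat \<Rightarrow> nat) \<Rightarrow> nat \<Rightarrow> (nat \<Rightarrow> real) \<Rightarrow> bool" where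
  "luce_distributed M X n \<theta> \<longleftrightarrow>
     prob_space M \<and>
     X \<in> measurable M (count_space {\<sigma>. \<sigma> permutes {1..n}}) \<and>
     (\<forall>\<sigma>. \<sigma> permutes {1..n} \<longrightarrow>
        measure M {\<omega> \<in> space M. X \<omega> = \<sigma>} = luce_p n (\<lambda>j. \<theta> (inv \<sigma> j)))"

text \<open>The \<open>j\<close>-th smallest element of \<open>I\<close>, counting from \<open>1\<close>.\<close>

definition nth_elem :: "nat set \<Rightarrow> nat \<Rightarrow> nat" where
  "nth_elem I j = sorted_list_of_set I ! (j - 1)"

definition pat :: "nat set \<Rightarrow> (nat \<Rightarrow> nat) \<Rightarrow> (nat \<Rightarrow> nat)" where
  "pat I \<sigma> = (THE \<tau>. \<tau> permutes {1..card I} \<and>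
     (\<forall>a\<in>{1..card I}. \<forall>b\<in>{1..card I}.
        \<tau> a < \<tau> b \<longleftrightarrow> \<sigma> (nth_elem I a) < \<sigma> (nth_elem I b)))"

text \<open>The description above determines \<open>pat I \<sigma>\<close> whenever \<open>\<sigma>\<close> is injective on a finite \<open>I\<close>.\<close>

lemma permutes_eq_rank:
  fixes \<tau> :: "nat \<Rightarrow> nat"
  assumes "\<tau> permutes {1..k}" "a \<in> {1..k}"
  shows "\<tau> a = card {b \<in> {1..k}. \<tau> b \<le> \<tau> a}"
proof -
  have "\<tau> ` {b \<in> {1..k}. \<tau> b \<le> \<tau> a} = {1..\<tau> a}"
  proof (intro equalityI subsetI)
    fix y assume "y \<in> \<tau> ` {b \<in> {1..k}. \<tau> b \<le> \<tau> a}"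
    then show "y \<in> {1..\<tau> a}"
      using permutes_in_image[OF assms(1)] by fastforce
  next
    fix y assume y: "y \<in> {1..\<tau> a}"
    have "\<tau> a \<in> {1..k}" using permutes_in_image[OF assms(1)] assms(2) by blast
    with y have "y \<in> {1..k}" by auto
    then obtain b where "b \<in> {1..k}" "y = \<tau> b"
      using permutes_image[OF assms(1)] by blast
    with y show "y \<in> \<tau> ` {b \<in> {1..k}. \<tau> b \<le> \<tau> a}" by auto
  qed
  moreover have "inj_on \<tau> {b \<in> {1..k}. \<tau> b \<le> \<tau> a}"
    using permutes_inj[OF assms(1)] by (rule inj_on_subset) simp
  ultimately show ?thesis using card_image by fastforce
qed

lemma ex1_pat:
  fixes \<sigma> :: "nat \<Rightarrow> nat"
  assumes "finite I" "inj_on \<sigma> I"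
  shows "\<exists>!\<tau>. \<tau> permutes {1..card I} \<and>
     (\<forall>a\<in>{1..card I}. \<forall>b\<in>{1..card I}.
        \<tau> a < \<tau> b \<longleftrightarrow> \<sigma> (nth_elem I a) < \<sigma> (nth_elem I b))"
proof -
  define k where "k = card I"
  define s where "s = (\<lambda>a. \<sigma> (nth_elem I a))"
  have len: "length (sorted_list_of_set I) = k" by (simp add: k_def)
  have inj: "inj_on s {1..k}"
  proof (rule inj_onI)
    fix a b assume a: "a \<in> {1..k}" and b: "b \<in> {1..k}" and eq: "s a = s b"
    have "nth_elem I a \<in> I" "nth_elem I b \<in> I"
      using a b assms(1) len nth_mem[of "a - 1" "sorted_list_of_set I"]
        nth_mem[of "b - 1" "sorted_list_of_set I"]
      by (auto simp: nth_elem_def)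
    then have "nth_elem I a = nth_elem I b"
      using eq assms(2) by (auto simp: s_def inj_on_def)
    then have "a - 1 = b - 1"
      using a b len nth_eq_iff_index_eq[of "sorted_list_of_set I" "a - 1" "b - 1"]
      by (auto simp: nth_elem_def)
    then show "a = b" using a b by auto
  qed
  define r where "r = (\<lambda>a. if a \<in> {1..k} then card {b \<in> {1..k}. s b \<le> s a} else a)"
  have mono: "r a < r b" if "a \<in> {1..k}" "b \<in> {1..k}" "s a < s b" for a b
  proof -
    have "{c \<in> {1..k}. s c \<le> s a} \<subset> {c \<in> {1..k}. s c \<le> s b}"
    proof (rule psubsetI)
      show "{c \<in> {1..k}. s c \<le> s a} \<subseteq> {c \<in> {1..k}. s c \<le> s b}"
        using that by fastforce
      show "{c \<in> {1..k}. s c \<le> s a} \<noteq> {c \<in> {1..k}. s c \<le> s b}"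
        using that by (metis (mono_tags, lifting) leD le_refl mem_Collect_eq)
    qed
    then have "card {c \<in> {1..k}. s c \<le> s a} < card {c \<in> {1..k}. s c \<le> s b}"
      by (intro psubset_card_mono) auto
    then show ?thesis using that by (simp add: r_def)
  qed
  have r_less: "r a < r b \<longleftrightarrow> s a < s b" if "a \<in> {1..k}" "b \<in> {1..k}" for a b
    using mono[of a b] mono[of b a] that inj
    by (metis inj_on_eq_iff linorder_neqE_nat order_less_asym order_less_irrefl)
  have r_inj: "inj_on r {1..k}"
    using r_less inj by (metis inj_on_def linorder_neqE_nat order_less_irrefl)
  have r_in: "r a \<in> {1..k}" if a: "a \<in> {1..k}" for a
  proof -
    have "card {a} \<le> card {b \<in> {1..k}. s b \<le> s a}"
      using a by (intro card_mono) auto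
    moreover have "card {b \<in> {1..k}. s b \<le> s a} \<le> card {1..k}"
      by (intro card_mono) auto
    ultimately show ?thesis using a by (simp add: r_def)
  qed
  have "bij_betw r {1..k} {1..k}"
    using r_inj r_in by (metis bij_betw_def endo_inj_surj finite_atLeastAtMost image_subsetI)
  then have r_perm: "r permutes {1..k}"
    by (rule bij_imp_permutes) (auto simp: r_def)
  have uniq: "\<tau> = r"
    if "\<tau> permutes {1..k}" "\<forall>a\<in>{1..k}. \<forall>b\<in>{1..k}. \<tau> a < \<tau> b \<longleftrightarrow> s a < s b" for \<tau>
  proof
    fix a show "\<tau> a = r a"
    proof (cases "a \<in> {1..k}")
      case True
      then have "{b \<in> {1..k}. \<tau> b \<le> \<tau> a} = {b \<in> {1..k}. r b \<le> r a}"
        using that(2) r_less True by (metis (no_types, lifting) not_less)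
      then show ?thesis
        using permutes_eq_rank[OF that(1) True] permutes_eq_rank[OF r_perm True] by simp
    next
      case False
      then show ?thesis using permutes_not_in[OF that(1)] permutes_not_in[OF r_perm] by simp
    qed
  qed
  have "\<exists>!\<tau>. \<tau> permutes {1..k} \<and>
     (\<forall>a\<in>{1..k}. \<forall>b\<in>{1..k}. \<tau> a < \<tau> b \<longleftrightarrow> s a < s b)"
  proof (rule ex1I)
    show "r permutes {1..k} \<and> (\<forall>a\<in>{1..k}. \<forall>b\<in>{1..k}. r a < r b \<longleftrightarrow> s a < s b)"
      using r_perm r_less by blast
  qed (use uniq in blast)
  then show ?thesis by (simp add: k_def s_def)
qed

definition c_occ :: "nat \<Rightarrow> (nat \<Rightarrow> nat) \<Rightarrow> nat \<Rightarrow> (nat \<Rightarrow> nat) \<Rightarrow> nat" where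
  "c_occ k \<pi> n \<sigma> =
     card {I. I \<subseteq> {1..n} \<and> card I = k \<and> (\<exists>a b. I = {a..b}) \<and> pat I \<sigma> = \<pi>}"

text \<open>The step function \<open>f\<^sub>n(y) = \<theta>\<^bsub>\<lfloor>yn\<rfloor>\<^esub>\<close>, with the convention \<open>\<theta>\<^sub>0 = \<theta>\<^sub>1\<close>.\<close>

definition step_fun :: "nat \<Rightarrow> (nat \<Rightarrow> real) \<Rightarrow> real \<Rightarrow> real" where
  "step_fun n \<theta> y = \<theta> (max 1 (nat \<lfloor>y * real n\<rfloor>))"

text \<open>The joint law of i.i.d. standard exponential variables \<open>(E\<^sub>j)\<close>, \<open>j \<ge> 1\<close>.\<close>

definition iid_exp :: "(nat \<Rightarrow> real) measure" where
  "iid_exp = (\<Pi>\<^sub>M j\<in>{1..}. density lborel (\<lambda>x. ennreal (exponential_density 1 x)))"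

definition zeta_pat :: "(nat \<Rightarrow> nat) \<Rightarrow> nat \<Rightarrow> nat \<Rightarrow> real" where
  "zeta_pat \<pi> h k = measure iid_exp
     {E \<in> space iid_exp.
        (\<forall>j\<in>{1..<k}. E (inv \<pi> j) < E (inv \<pi> (j + 1))) \<and>
        (\<forall>j\<in>{1..<k}. E (h + inv \<pi> j) < E (h + inv \<pi> (j + 1)))}"

definition nu_inf :: "nat \<Rightarrow> (nat \<Rightarrow> nat) \<Rightarrow> real" where
  "nu_inf k \<pi> = 1 / fact k + (1 - 2 * real k) / (fact k)\<^sup>2 + 2 * (\<Sum>h=1..k-1. zeta_pat \<pi> h k)"

end

theory Submission
  imports Defs "HOL-Combinatorics.Multiset_Permutations"
begin

text \<open>
  The weights \<open>\<theta>\<close> drive a race: item \<open>j\<close> finishes at an exponential time of rate \<open>\<theta> j\<close>, and a Luce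
  permutation records the order of arrival. Everything rests on two features of this race.

  Locality. The order in which the items of a set \<open>I\<close> arrive is again a Luce order with the same
  weights, and it is independent of the order in any disjoint set. Here this is proved without the
  clocks: the Luce weights of all shuffles of two lists add up to the product of the two weights
  (\<open>sum_luce_list_shuffles\<close>), because the first entry of a shuffle comes from either list with
  probability proportional to the total weight of that list. Consequently the probability that a
  window \<open>{i+1..i+k}\<close> shows the pattern \<open>\<pi>\<close> is the summand \<open>luce_p\<close> of the theorem, disjoint windows
  are independent, and the probability that two windows at distance \<open>h < k\<close> both show \<open>\<pi>\<close> is a sum of
  terms \<open>luce_p (h + k)\<close> over the permutations of the union of the windows that show \<open>\<pi>\<close> at both
  places (\<open>overlap_perms\<close>). The same permutations describe the event in \<open>zeta_pat\<close>, and for i.i.d.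
  clocks every order of \<open>m\<close> clocks has probability \<open>1 / m!\<close>, so \<open>zeta_pat\<close> is the number of these
  permutations divided by \<open>(h + k)!\<close> (\<open>zeta_pat_eq_card\<close>).

  Slow variation. Since \<open>step_fun n (\<theta> n)\<close> converges almost everywhere to a positive finite function,
  and that function is close to a continuous one outside a small set, all but \<open>o(n)\<close> of the ratios
  of neighbouring weights are close to \<open>1\<close> (\<open>few_rough_steps\<close>). On a window with nearly equal weights
  \<open>luce_p m\<close> is close to \<open>1 / m!\<close>; hence it is \<open>1 / m!\<close> on average over the windows, with the absolute
  deviations tending to zero in mean (\<open>conv_in_mean_luce_p\<close>). For \<open>m = k\<close> this is the first claim.

  The number of occurrences is a sum of \<open>n + 1 - k\<close> indicators. Its variance is a sum of covariances,
  in which only pairs of windows at distance \<open>h < k\<close> survive (\<open>variance_c_occ\<close>). Averaging each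
  diagonal \<open>h\<close> by means of convergence in mean turns the diagonal \<open>h = 0\<close> into \<open>1 / k! - 1 / (k!)\<^sup>2\<close> and
  each of the two diagonals at distance \<open>h\<close> into \<open>zeta_pat \<pi> h k - 1 / (k!)\<^sup>2\<close>; these add up to
  \<open>nu_inf k \<pi>\<close>.
\<close>

section \<open>The Luce law on lists\<close>

fun luce_list :: "('a \<Rightarrow> real) \<Rightarrow> 'a list \<Rightarrow> real" where
  "luce_list w [] = 1"
| "luce_list w (x # xs) = w x / sum_list (map w (x # xs)) * luce_list w xs"

definition luce_prob :: "('a \<Rightarrow> real) \<Rightarrow> 'a set \<Rightarrow> ('a list \<Rightarrow> bool) \<Rightarrow> real" where
  "luce_prob w S P = (\<Sum>l | l \<in> permutations_of_set S \<and> P l. luce_list w l)"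

text \<open>
  Removing the first item leaves a race among the others, which makes \<open>luce_p\<close> a recursive function
  on lists.
\<close>

lemma luce_p_Suc:
  "luce_p (Suc k) x = x 1 / (\<Sum>l=1..Suc k. x l) * luce_p k (\<lambda>j. x (Suc j))"
proof -
  have split: "(\<Sum>l=1..Suc m. x l) = x 1 + (\<Sum>l=1..m. x (Suc l))" for m
    using sum.atLeast_Suc_atMost[of 1 "Suc m" x]
    using sum.shift_bounds_cl_Suc_ivl[of x 1 m] by (simp del: sum.cl_ivl_Suc)
  have split': "(\<Sum>l=1..<Suc m. x l) = x 1 + (\<Sum>l=1..<m. x (Suc l))" if "m \<ge> 1" for m
    using that sum.atLeast_Suc_lessThan[of 1 "Suc m" x] sum.shift_bounds_Suc_ivl[of x 1 m] by simp
  let ?g = "\<lambda>j. x j / ((\<Sum>l=1..Suc k. x l) - (\<Sum>l=1..<j. x l))"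
  have "luce_p (Suc k) x = ?g 1 * (\<Prod>j=1..k. ?g (Suc j))"
    unfolding luce_p_def
    using prod.atLeast_Suc_atMost[of 1 "Suc k" ?g] prod.shift_bounds_cl_Suc_ivl[of ?g 1 k] by simp
  also have "(\<Prod>j=1..k. ?g (Suc j)) = luce_p k (\<lambda>j. x (Suc j))"
    unfolding luce_p_def by (intro prod.cong refl, subst split, subst split') auto
  finally show ?thesis by simp
qed

lemma luce_p_eq_luce_list: "luce_p k (\<lambda>j. w (g j)) = luce_list w (map g [1..<k+1])"
proof (induction k arbitrary: g)
  case 0
  then show ?case by (simp add: luce_p_def)
next
  case (Suc k)
  have e: "[1..<Suc k + 1] = 1 # map Suc [1..<k+1]"
    by (simp add: upt_conv_Cons map_Suc_upt del: upt_Suc)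
  have "sum_list (map w (map g [1..<Suc k + 1])) = (\<Sum>l=1..Suc k. w (g l))"
    by (simp add: interv_sum_list_conv_sum_set_nat atLeastLessThanSuc_atLeastAtMost o_def
          del: sum.op_ivl_Suc sum.cl_ivl_Suc upt_Suc)
  then have s: "sum_list (map w (map g (1 # map Suc [1..<k+1]))) = (\<Sum>l=1..Suc k. w (g l))"
    by (simp only: e)
  show ?case
    using s Suc.IH[of "\<lambda>j. g (Suc j)"]
    by (simp only: luce_p_Suc e list.map luce_list.simps map_map o_def)
qed

text \<open>
  With \<open>A\<close> and \<open>B\<close> the total weights of the two lists, a shuffle begins with an entry \<open>x\<close> of \<open>xs\<close> with
  weight \<open>w x / (A + B)\<close> in place of the weight \<open>w x / A\<close> within \<open>xs\<close> alone. By induction the shuffles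
  beginning in \<open>xs\<close> contribute the fraction \<open>A / (A + B)\<close> of the product, those beginning in \<open>ys\<close> the
  fraction \<open>B / (A + B)\<close>.
\<close>

lemma sum_luce_list_shuffles:
  assumes "set xs \<inter> set ys = {}" "\<And>x. x \<in> set xs \<union> set ys \<Longrightarrow> w x > 0"
  shows "(\<Sum>zs\<in>shuffles xs ys. luce_list w zs) = luce_list w xs * luce_list w ys"
  using assms
proof (induction xs ys rule: shuffles.induct)
  case (3 x xs y ys)
  let ?A = "sum_list (map w (x # xs))" and ?B = "sum_list (map w (y # ys))"
  have pos: "?A > 0" "?B > 0"
    using "3.prems" by (auto intro!: add_pos_nonneg sum_list_nonneg simp: less_imp_le)
  have sl: "sum_list (map w zs) = sum_list (map w as) + sum_list (map w bs)"
    if "zs \<in> shuffles as bs" for zs as bs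
    using mset_shuffles[OF that] by (metis mset_map map_append mset_append sum_list_append sum_mset_sum_list)
  have "(\<Sum>zs\<in>shuffles (x#xs) (y#ys). luce_list w zs) =
      (\<Sum>zs\<in>(#) x ` shuffles xs (y#ys). luce_list w zs) + (\<Sum>zs\<in>(#) y ` shuffles (x#xs) ys. luce_list w zs)"
    unfolding shuffles.simps using "3.prems"(1) by (intro sum.union_disjoint) auto
  also have "(\<Sum>zs\<in>(#) x ` shuffles xs (y#ys). luce_list w zs) =
      (\<Sum>zs\<in>shuffles xs (y#ys). w x / (?A + ?B) * luce_list w zs)"
    by (subst sum.reindex) (auto intro!: sum.cong simp: sl algebra_simps)
  also have "\<dots> = w x / (?A + ?B) * (luce_list w xs * luce_list w (y#ys))"
    using "3.IH"(1) "3.prems" by (subst sum_distrib_left [symmetric]) (auto simp del: luce_list.simps)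
  also have "(\<Sum>zs\<in>(#) y ` shuffles (x#xs) ys. luce_list w zs) =
      (\<Sum>zs\<in>shuffles (x#xs) ys. w y / (?A + ?B) * luce_list w zs)"
    by (subst sum.reindex) (auto intro!: sum.cong simp: sl algebra_simps)
  also have "\<dots> = w y / (?A + ?B) * (luce_list w (x#xs) * luce_list w ys)"
    using "3.IH"(2) "3.prems" by (subst sum_distrib_left [symmetric]) (simp del: luce_list.simps)
  also have "w x / (?A + ?B) * (luce_list w xs * luce_list w (y#ys)) + 
     w y / (?A + ?B) * (luce_list w (x#xs) * luce_list w ys) = luce_list w (x#xs) * luce_list w (y#ys)"
  proof -
    define A B where "A = ?A" and "B = ?B"
    have p: "A > 0" "B > 0" using pos unfolding A_def B_def .
    have l: "luce_list w (x#xs) = w x / A * luce_list w xs" "luce_list w (y#ys) = w y / B * luce_list w ys"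
      by (simp_all add: A_def B_def)
    have "A + B \<noteq> 0" using p by linarith
    then have "w x / (A+B) * (a * (w y / B * b)) + w y / (A+B) * (w x / A * a * b) = w x / A * a * (w y / B * b)" for a b
      using p by (simp add: divide_simps) algebra
    then show ?thesis unfolding l A_def[symmetric] B_def[symmetric] .
  qed
  finally show ?case .
qed auto

text \<open>
  The orderings of \<open>S\<close> that restrict to \<open>xs\<close> on \<open>I\<close> are the shuffles of \<open>xs\<close> with the orderings of
  \<open>S - I\<close>. This one identity yields the total mass, the marginals and the independence of disjoint
  sets.
\<close>

lemma luce_prob_filter_and_rest:
  assumes "finite S" "I \<subseteq> S" "xs \<in> permutations_of_set I" "\<And>x. x \<in> S \<Longrightarrow> w x > 0"
  shows "luce_prob w S (\<lambda>l. filter (\<lambda>x. x \<in> I) l = xs \<and> P (filter (\<lambda>x. x \<notin> I) l))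
       = luce_list w xs * luce_prob w (S - I) P"
proof -
  let ?C = "{ys \<in> permutations_of_set (S - I). P ys}"
  let ?D = "{l \<in> permutations_of_set S. filter (\<lambda>x. x \<in> I) l = xs \<and> P (filter (\<lambda>x. x \<notin> I) l)}"
  have xs: "set xs = I" "distinct xs"
    using assms(3) by (auto simp: permutations_of_set_def)
  have flt: "filter (\<lambda>x. x \<in> I) zs = xs" "filter (\<lambda>x. x \<notin> I) zs = ys"
    if "ys \<in> permutations_of_set (S - I)" "zs \<in> shuffles xs ys" for ys zs
    using filter_shuffles_disjoint1[of xs ys zs] that xs(1) permutations_of_setD(1)[OF that(1)] by auto
  have eq: "?D = (\<Union>ys\<in>?C. shuffles xs ys)"
  proof (intro equalityI subsetI)
    fix l assume l: "l \<in> ?D"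
    have "l \<in> shuffles (filter (\<lambda>x. x \<in> I) l) (filter (\<lambda>x. x \<notin> I) l)"
      by (rule partition_in_shuffles)
    moreover have "filter (\<lambda>x. x \<notin> I) l \<in> ?C"
      using l by (auto simp: permutations_of_set_def)
    ultimately show "l \<in> (\<Union>ys\<in>?C. shuffles xs ys)" using l by auto
  next
    fix l assume "l \<in> (\<Union>ys\<in>?C. shuffles xs ys)"
    then obtain ys where ys: "ys \<in> permutations_of_set (S - I)" "P ys" "l \<in> shuffles xs ys" by auto
    have s: "set ys = S - I" "distinct ys" using permutations_of_setD[OF ys(1)] .
    have "set l = S" using set_shuffles[OF ys(3)] s(1) xs(1) assms(2) by auto
    moreover have "distinct l"
      using distinct_disjoint_shuffles[OF xs(2) s(2) _ ys(3)] s(1) xs(1) by auto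
    ultimately show "l \<in> ?D" using flt[OF ys(1,3)] ys(2) by (simp add: permutations_of_set_def)
  qed
  have "luce_prob w S (\<lambda>l. filter (\<lambda>x. x \<in> I) l = xs \<and> P (filter (\<lambda>x. x \<notin> I) l)) =
     (\<Sum>l\<in>(\<Union>ys\<in>?C. shuffles xs ys). luce_list w l)"
    unfolding luce_prob_def eq ..
  also have "\<dots> = (\<Sum>ys\<in>?C. \<Sum>l\<in>shuffles xs ys. luce_list w l)"
    using flt by (intro sum.UNION_disjoint) (auto, metis)
  also have "\<dots> = (\<Sum>ys\<in>?C. luce_list w xs * luce_list w ys)"
  proof (rule sum.cong[OF refl])
    fix ys assume "ys \<in> ?C"
    then have "set ys = S - I" by (auto simp: permutations_of_set_def)
    then show "(\<Sum>l\<in>shuffles xs ys. luce_list w l) = luce_list w xs * luce_list w ys"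
      using xs(1) assms(2,4) by (intro sum_luce_list_shuffles) auto
  qed
  finally show ?thesis by (simp add: luce_prob_def sum_distrib_left)
qed

lemma luce_prob_UNIV:
  assumes "finite S" "\<And>x. x \<in> S \<Longrightarrow> w x > 0"
  shows "luce_prob w S (\<lambda>_. True) = 1"
  using assms
proof (induction S rule: finite_induct)
  case empty
  then show ?case by (simp add: luce_prob_def)
next
  case (insert x S)
  \<comment> \<open>Splitting off a singleton, which can be ordered in one way only, removes one item at a time.\<close>
  have "filter (\<lambda>y. y \<in> {x}) l = [x]" if "l \<in> permutations_of_set (insert x S)" for l
  proof -
    have "filter (\<lambda>y. y \<in> {x}) l \<in> permutations_of_set {x}"
      using that by (auto simp: permutations_of_set_def)
    then show ?thesis by simp
  qed
  then have "luce_prob w (insert x S) (\<lambda>_. True)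
    = luce_prob w (insert x S) (\<lambda>l. filter (\<lambda>y. y \<in> {x}) l = [x] \<and> True)"
    unfolding luce_prob_def by (intro sum.cong) auto
  also have "\<dots> = luce_list w [x] * luce_prob w (insert x S - {x}) (\<lambda>_. True)"
    using insert.hyps(1) insert.prems by (intro luce_prob_filter_and_rest) auto
  also have "insert x S - {x} = S" using insert.hyps(2) by auto
  also have "luce_list w [x] = 1" using insert.prems[of x] by simp
  finally show ?case using insert.IH insert.prems by simp
qed

lemma luce_prob_filter:
  assumes "finite S" "I \<subseteq> S" "xs \<in> permutations_of_set I" "\<And>x. x \<in> S \<Longrightarrow> w x > 0"
  shows "luce_prob w S (\<lambda>l. filter (\<lambda>x. x \<in> I) l = xs) = luce_list w xs"
  using luce_prob_filter_and_rest[OF assms, where P = "\<lambda>_. True"] luce_prob_UNIV[of "S - I" w] assms by simp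

lemma luce_prob_filter_disjoint:
  assumes "finite S" "I \<subseteq> S" "J \<subseteq> S" "I \<inter> J = {}"
    and "xs \<in> permutations_of_set I" "ys \<in> permutations_of_set J" "\<And>x. x \<in> S \<Longrightarrow> w x > 0"
  shows "luce_prob w S (\<lambda>l. filter (\<lambda>x. x \<in> I) l = xs \<and> filter (\<lambda>x. x \<in> J) l = ys)
       = luce_list w xs * luce_list w ys"
proof -
  have "filter (\<lambda>x. x \<in> J) l = filter (\<lambda>x. x \<in> J) (filter (\<lambda>x. x \<notin> I) l)" for l
    using assms(4) by (auto simp: filter_filter intro!: filter_cong)
  then have "luce_prob w S (\<lambda>l. filter (\<lambda>x. x \<in> I) l = xs \<and> filter (\<lambda>x. x \<in> J) l = ys)
    = luce_prob w S (\<lambda>l. filter (\<lambda>x. x \<in> I) l = xs \<and> filter (\<lambda>x. x \<in> J) (filter (\<lambda>x. x \<notin> I) l) = ys)"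
    by simp
  also have "\<dots> = luce_list w xs * luce_prob w (S - I) (\<lambda>l. filter (\<lambda>x. x \<in> J) l = ys)"
    using assms by (intro luce_prob_filter_and_rest)
  also have "luce_prob w (S - I) (\<lambda>l. filter (\<lambda>x. x \<in> J) l = ys) = luce_list w ys"
    using assms by (intro luce_prob_filter) auto
  finally show ?thesis .
qed

section \<open>Permutations as orders\<close>

text \<open>
  Replacing the values by their ranks reduces the claim to the patterns of functions on \<open>nat\<close>.
\<close>

lemma ex_rank_permutation:
  fixes E :: "nat \<Rightarrow> 'a::linorder"
  assumes "inj_on E {1..m}"
  shows "\<exists>\<tau>. \<tau> permutes {1..m} \<and> (\<forall>a\<in>{1..m}. \<forall>b\<in>{1..m}. \<tau> a < \<tau> b \<longleftrightarrow> E a < E b)"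
proof -
  define r where "r = (\<lambda>a. card {b \<in> {1..m}. E b < E a})"
  have mono: "r a < r b" if "a \<in> {1..m}" "E a < E b" for a b
    unfolding r_def using that by (intro psubset_card_mono) (auto intro: less_trans)
  have r_iff: "r a < r b \<longleftrightarrow> E a < E b" if "a \<in> {1..m}" "b \<in> {1..m}" for a b
    using mono[of a b] mono[of b a] that assms
    by (metis inj_on_eq_iff less_asym less_irrefl linorder_less_linear)
  have "inj_on r {1..m}"
    using r_iff assms by (metis inj_on_def less_irrefl linorder_less_linear)
  then obtain \<tau> where "\<tau> permutes {1..card {1..m}}"
    "\<forall>a\<in>{1..card {1..m}}. \<forall>b\<in>{1..card {1..m}}. \<tau> a < \<tau> b \<longleftrightarrow> r (nth_elem {1..m} a) < r (nth_elem {1..m} b)"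
    using ex1_pat[of "{1..m}" r] by auto
  moreover have "nth_elem {1..m} a = a" if "a \<in> {1..m}" for a
    using that sorted_list_of_set_range[of 1 "Suc m"]
    by (simp add: nth_elem_def atLeastLessThanSuc_atLeastAtMost del: sorted_list_of_set_range upt_Suc)
  ultimately have "\<tau> permutes {1..m}" "\<forall>a\<in>{1..m}. \<forall>b\<in>{1..m}. \<tau> a < \<tau> b \<longleftrightarrow> E a < E b"
    using r_iff by simp_all
  then show ?thesis by blast
qed

text \<open>
  A permutation carries the same order as \<open>E\<close> as soon as \<open>E\<close> increases along its inverse; it suffices
  to compare consecutive ranks, which is the form in which the event of \<open>zeta_pat\<close> is given.
\<close>

lemma less_iff_increasing_along_inverse:
  fixes E :: "nat \<Rightarrow> 'a::linorder"
  assumes "\<tau> permutes {1..m}"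
  shows "(\<forall>a\<in>{1..m}. \<forall>b\<in>{1..m}. \<tau> a < \<tau> b \<longleftrightarrow> E a < E b)
     \<longleftrightarrow> (\<forall>j\<in>{1..<m}. E (inv \<tau> j) < E (inv \<tau> (j + 1)))" (is "?L \<longleftrightarrow> ?R")
proof
  have in_iff: "inv \<tau> j \<in> {1..m} \<longleftrightarrow> j \<in> {1..m}" for j
    using permutes_in_image[OF permutes_inv[OF assms]] .
  have inv: "\<tau> (inv \<tau> j) = j" "inv \<tau> (\<tau> j) = j" for j
    using permutes_inverses[OF assms] by auto
  show ?R if ?L
  proof
    fix j assume "j \<in> {1..<m}"
    then have "inv \<tau> j \<in> {1..m}" "inv \<tau> (j + 1) \<in> {1..m}" unfolding in_iff by auto
    with that show "E (inv \<tau> j) < E (inv \<tau> (j + 1))" by (metis inv(1) less_add_one)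
  qed
  show ?L if R: ?R
  proof -
    have chain: "E (inv \<tau> i) < E (inv \<tau> j)" if "i < j" "1 \<le> i" "j \<le> m" for i j
      using that
    proof (induction j)
      case (Suc j)
      have "E (inv \<tau> j) < E (inv \<tau> (Suc j))" using R Suc.prems by auto
      then show ?case using Suc by (cases "i = j") (auto intro: less_trans)
    qed simp
    have "E a < E b" if "a \<in> {1..m}" "b \<in> {1..m}" "\<tau> a < \<tau> b" for a b
    proof -
      have "\<tau> a \<in> {1..m}" "\<tau> b \<in> {1..m}" using that permutes_in_image[OF assms] by auto
      then show ?thesis using chain[of "\<tau> a" "\<tau> b"] that by (simp add: inv)
    qed
    moreover have "a = b" if "\<tau> a = \<tau> b" for a b using that by (metis inv(2))
    ultimately show ?L
      by (metis less_asym less_irrefl linorder_less_linear)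
  qed
qed

lemma permutes_eqI_order:
  fixes m :: nat
  assumes "\<tau> permutes {1..m}" "\<rho> permutes {1..m}"
    and "\<And>a b. a \<in> {1..m} \<Longrightarrow> b \<in> {1..m} \<Longrightarrow> \<tau> a < \<tau> b \<longleftrightarrow> \<rho> a < \<rho> b"
  shows "\<tau> = \<rho>"
proof
  fix a
  show "\<tau> a = \<rho> a"
  proof (cases "a \<in> {1..m}")
    case True
    have "\<tau> b \<le> \<tau> a \<longleftrightarrow> \<rho> b \<le> \<rho> a" if "b \<in> {1..m}" for b
      using assms(3)[OF True that] by (simp only: linorder_not_less [symmetric])
    then have "{b \<in> {1..m}. \<tau> b \<le> \<tau> a} = {b \<in> {1..m}. \<rho> b \<le> \<rho> a}" by blast
    then show ?thesis
      using permutes_eq_rank[OF assms(1) True] permutes_eq_rank[OF assms(2) True] by simp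
  next
    case False
    then show ?thesis using assms(1,2) by (simp add: permutes_not_in)
  qed
qed

section \<open>Independent exponential clocks\<close>

lemma prob_space_exponential: "prob_space (density lborel (\<lambda>x. ennreal (exponential_density 1 x)))"
  by (rule prob_space_exponential_density) simp

lemma prob_space_iid_exp: "prob_space iid_exp"
  unfolding iid_exp_def by (intro prob_space_PiM prob_space_exponential)

lemma sets_iid_exp: "sets iid_exp = sets (\<Pi>\<^sub>M j\<in>{1..}. borel)"
  unfolding iid_exp_def by (intro sets_PiM_cong) auto

lemma measurable_iid_exp_coord: "i \<in> {1..} \<Longrightarrow> (\<lambda>E. E i) \<in> borel_measurable iid_exp"
  using measurable_component_singleton[of i "{1..}" "\<lambda>_. borel"]
  by (simp add: measurable_cong_sets[OF sets_iid_exp refl])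

text \<open>
  Given all the other clocks, clock \<open>i\<close> has a law without atoms, so it misses the value of clock \<open>j\<close>.
\<close>

lemma AE_iid_exp_neq:
  assumes ij: "i \<in> {1..}" "j \<in> {1..}" "i \<noteq> j"
  shows "AE E in iid_exp. E i \<noteq> E j"
proof -
  let ?X = "density lborel (\<lambda>x. ennreal (exponential_density 1 x))"
  let ?P = "\<Pi>\<^sub>M l\<in>{1..} - {i}. ?X"
  interpret X: prob_space ?X by (rule prob_space_exponential)
  interpret P: prob_space ?P by (intro prob_space_PiM prob_space_exponential)
  interpret XP: pair_sigma_finite ?X ?P ..
  have [measurable_cong]: "sets ?X = sets borel" by simp
  have [measurable]: "(\<lambda>E. E j) \<in> borel_measurable ?P"
    using measurable_component_singleton[of j "{1..} - {i}" "\<lambda>_. ?X"] ij by simp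
  have neq: "AE x in ?X. x \<noteq> c" for c
    using AE_lborel_singleton[of c] by (subst AE_density) auto
  have ms: "{z \<in> space (?X \<Otimes>\<^sub>M ?P). fst z \<noteq> snd z j} \<in> sets (?X \<Otimes>\<^sub>M ?P)" by measurable
  have "AE E in ?P. AE x in ?X. x \<noteq> E j" by (intro AE_I2 neq)
  then have "AE x in ?X. AE E in ?P. x \<noteq> E j"
    using XP.AE_commute[OF ms] by blast
  then have "AE z in ?X \<Otimes>\<^sub>M ?P. fst z \<noteq> snd z j"
    using XP.AE_pair_measure[OF ms] by simp
  then have "AE z in ?X \<Otimes>\<^sub>M ?P. (\<lambda>(x, E). E(i := x)) z i \<noteq> (\<lambda>(x, E). E(i := x)) z j"
    by eventually_elim (use ij in \<open>auto simp: case_prod_beta\<close>)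
  moreover have "(\<lambda>(x, E). E(i := x)) \<in> measurable (?X \<Otimes>\<^sub>M ?P) iid_exp"
    unfolding iid_exp_def case_prod_beta using ij(1)
    by (intro measurable_fun_upd[where J = "{1..} - {i}"]) auto
  moreover have "{E \<in> space iid_exp. E i \<noteq> E j} \<in> sets iid_exp"
    using ij by (intro borel_measurable_neq measurable_iid_exp_coord)
  ultimately have "AE E in distr (?X \<Otimes>\<^sub>M ?P) iid_exp (\<lambda>(x, E). E(i := x)). E i \<noteq> E j"
    by (subst AE_distr_iff) auto
  also have "distr (?X \<Otimes>\<^sub>M ?P) iid_exp (\<lambda>(x, E). E(i := x)) = iid_exp"
  proof -
    have "insert i ({1..} - {i}) = {1..}" using ij(1) by auto
    then show ?thesis
      using distr_pair_PiM_eq_PiM[OF prob_space_exponential prob_space_exponential, of "{1..} - {i}" i]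
      unfolding iid_exp_def by simp
  qed
  finally show ?thesis .
qed

definition sorted_by :: "nat \<Rightarrow> (nat \<Rightarrow> nat) \<Rightarrow> (nat \<Rightarrow> real) set" where
  "sorted_by m \<tau> = {E \<in> space iid_exp. \<forall>j\<in>{1..<m}. E (inv \<tau> j) < E (inv \<tau> (j + 1))}"

lemma sets_sorted_by:
  assumes "\<tau> permutes {1..m}"
  shows "sorted_by m \<tau> \<in> sets iid_exp"
  unfolding sorted_by_def
proof (intro sets.sets_Collect_finite_All borel_measurable_less measurable_iid_exp_coord)
  fix j assume j: "j \<in> {1..<m}"
  show "inv \<tau> j \<in> {1..}" "inv \<tau> (j + 1) \<in> {1..}"
    using j permutes_in_image[OF permutes_inv[OF assms], of j] permutes_in_image[OF permutes_inv[OF assms], of "j + 1"]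
    by auto
qed auto

lemma sorted_by_iff:
  assumes "\<tau> permutes {1..m}"
  shows "E \<in> sorted_by m \<tau> \<longleftrightarrow>
    E \<in> space iid_exp \<and> (\<forall>a\<in>{1..m}. \<forall>b\<in>{1..m}. \<tau> a < \<tau> b \<longleftrightarrow> E a < E b)"
  unfolding sorted_by_def mem_Collect_eq less_iff_increasing_along_inverse[OF assms] ..

lemma disjoint_sorted_by: "disjoint_family_on (sorted_by m) {\<tau>. \<tau> permutes {1..m}}"
  unfolding disjoint_family_on_def
proof (intro ballI impI, rule ccontr)
  fix \<tau> \<rho> assume *: "\<tau> \<in> {\<tau>. \<tau> permutes {1..m}}" "\<rho> \<in> {\<tau>. \<tau> permutes {1..m}}" "\<tau> \<noteq> \<rho>"
    "sorted_by m \<tau> \<inter> sorted_by m \<rho> \<noteq> {}"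
  then obtain E where "E \<in> sorted_by m \<tau>" "E \<in> sorted_by m \<rho>" by blast
  then have "\<tau> = \<rho>"
    using * sorted_by_iff by (intro permutes_eqI_order[of _ m]) auto
  with * show False by simp
qed

lemma AE_sorted_by: "AE E in iid_exp. \<exists>\<tau>. \<tau> permutes {1..m} \<and> E \<in> sorted_by m \<tau>"
proof -
  have "AE E in iid_exp. \<forall>i\<in>{1..m}. \<forall>j\<in>{1..m}. i \<noteq> j \<longrightarrow> E i \<noteq> E j"
    using AE_iid_exp_neq by (intro AE_finite_allI) (auto intro: AE_impI)
  moreover have "AE E in iid_exp. E \<in> space iid_exp" by (rule AE_space)
  ultimately show ?thesis
  proof eventually_elim
    case (elim E)
    then have "inj_on E {1..m}" by (auto simp: inj_on_def)
    from ex_rank_permutation[OF this] elim(2) show ?case using sorted_by_iff by blast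
  qed
qed

text \<open>
  By exchangeability all \<open>m!\<close> orders are equally likely, and their probabilities add up to \<open>1\<close> since
  there are almost surely no ties.
\<close>

lemma measure_sorted_by:
  assumes tau: "\<tau> permutes {1..m}"
  shows "measure iid_exp (sorted_by m \<tau>) = 1 / fact m"
proof -
  interpret prob_space iid_exp by (rule prob_space_iid_exp)
  have exch: "prob (sorted_by m \<rho>) = prob (sorted_by m id)" if rho: "\<rho> permutes {1..m}" for \<rho>
  proof -
    let ?t = "\<lambda>E. \<lambda>n\<in>{1..}. E (inv \<rho> n)"
    have inv: "inv \<rho> permutes {1..m}" using rho by (rule permutes_inv)
    have into: "inv \<rho> n \<in> {1..}" if "n \<in> {1..}" for n
      using that permutes_in_image[OF inv, of n] permutes_not_in[OF inv, of n] by (cases "n \<in> {1..m}") auto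
    have "inj_on (inv \<rho>) {1..}" using permutes_inj[OF inv] by (rule inj_on_subset) simp
    then have d: "distr iid_exp iid_exp ?t = iid_exp"
      unfolding iid_exp_def using into
      by (intro distr_PiM_reindex[where M = "\<lambda>_. density lborel (\<lambda>x. ennreal (exponential_density 1 x))"]
          prob_space_exponential) auto
    have tm: "?t \<in> measurable iid_exp iid_exp"
      unfolding iid_exp_def using into by (intro measurable_restrict measurable_component_singleton) auto
    \<comment> \<open>Relabelling the clocks by the inverse permutation preserves the product law.\<close>
    have "prob (sorted_by m id) = measure (distr iid_exp iid_exp ?t) (sorted_by m id)" by (subst d) (rule refl)
    also have "\<dots> = prob (?t -` sorted_by m id \<inter> space iid_exp)"
      using tm sets_sorted_by[OF permutes_id] by (rule measure_distr)
    also have "?t -` sorted_by m id \<inter> space iid_exp = sorted_by m \<rho>"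
      using measurable_space[OF tm] by (auto simp: sorted_by_def inv_id)
    finally show ?thesis ..
  qed
  let ?S = "{\<tau>. \<tau> permutes {1..m}}"
  have "prob (\<Union>\<tau>\<in>?S. sorted_by m \<tau>) = 1"
  proof (subst prob_eq_1)
    show "(\<Union>\<tau>\<in>?S. sorted_by m \<tau>) \<in> events"
      by (intro sets.finite_UN finite_permutations) (auto intro: sets_sorted_by)
    show "AE E in iid_exp. E \<in> (\<Union>\<tau>\<in>?S. sorted_by m \<tau>)"
      using AE_sorted_by[of m] by (auto simp: Bex_def)
  qed
  moreover have "prob (\<Union>\<tau>\<in>?S. sorted_by m \<tau>) = (\<Sum>\<tau>\<in>?S. prob (sorted_by m \<tau>))"
    by (intro finite_measure_finite_Union disjoint_sorted_by finite_permutations) (auto intro: sets_sorted_by)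
  also have "\<dots> = (\<Sum>\<tau>\<in>?S. prob (sorted_by m id))" by (intro sum.cong exch) auto
  also have "\<dots> = fact m * prob (sorted_by m id)" by (simp add: card_permutations)
  finally show ?thesis using exch[OF tau] by (simp add: field_simps)
qed

text \<open>
  The patterns of \<open>h + k\<close> consecutive positions that show \<open>\<pi>\<close> both on the first \<open>k\<close> and on the last
  \<open>k\<close> positions.
\<close>

definition overlap_perms :: "nat \<Rightarrow> (nat \<Rightarrow> nat) \<Rightarrow> nat \<Rightarrow> (nat \<Rightarrow> nat) set" where
  "overlap_perms k \<pi> h = {\<tau>. \<tau> permutes {1..h + k} \<and>
     (\<forall>j\<in>{1..<k}. \<tau> (inv \<pi> j) < \<tau> (inv \<pi> (j + 1))) \<and>
     (\<forall>j\<in>{1..<k}. \<tau> (h + inv \<pi> j) < \<tau> (h + inv \<pi> (j + 1)))}"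

lemma finite_overlap_perms: "finite (overlap_perms k \<pi> h)"
  by (rule finite_subset[OF _ finite_permutations[of "{1..h + k}"]]) (auto simp: overlap_perms_def)

lemma zeta_pat_eq_card:
  assumes pi: "\<pi> permutes {1..k}"
  shows "zeta_pat \<pi> h k = real (card (overlap_perms k \<pi> h)) / fact (h + k)"
proof -
  interpret prob_space iid_exp by (rule prob_space_iid_exp)
  let ?T = "overlap_perms k \<pi> h"
  let ?Q = "\<lambda>E. (\<forall>j\<in>{1..<k}. E (inv \<pi> j) < E (inv \<pi> (j + 1))) \<and>
        (\<forall>j\<in>{1..<k}. E (h + inv \<pi> j) < E (h + inv \<pi> (j + 1)))"
  have perm: "\<tau> permutes {1..h + k}" if "\<tau> \<in> ?T" for \<tau> using that by (simp add: overlap_perms_def)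
  have inpi: "inv \<pi> j \<in> {1..k}" if "j \<in> {1..k}" for j
    using that permutes_in_image[OF permutes_inv[OF pi]] by blast
  have iff: "?Q E \<longleftrightarrow> \<tau> \<in> ?T" if "\<tau> permutes {1..h + k}" "E \<in> sorted_by (h + k) \<tau>" for \<tau> E
  proof -
    have *: "\<tau> a < \<tau> b \<longleftrightarrow> E a < E b" if "a \<in> {1..h + k}" "b \<in> {1..h + k}" for a b
      using sorted_by_iff \<open>\<tau> permutes _\<close> \<open>E \<in> _\<close> that by blast
    have "\<tau> (inv \<pi> j) < \<tau> (inv \<pi> (j + 1)) \<longleftrightarrow> E (inv \<pi> j) < E (inv \<pi> (j + 1))"
      "\<tau> (h + inv \<pi> j) < \<tau> (h + inv \<pi> (j + 1)) \<longleftrightarrow> E (h + inv \<pi> j) < E (h + inv \<pi> (j + 1))"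
      if "j \<in> {1..<k}" for j
      using inpi[of j] inpi[of "j + 1"] that by (auto intro!: *)
    then show ?thesis using that(1) by (simp add: overlap_perms_def)
  qed
  have "zeta_pat \<pi> h k = prob (\<Union>\<tau>\<in>?T. sorted_by (h + k) \<tau>)"
    unfolding zeta_pat_def
  proof (rule finite_measure_eq_AE)
    show "AE E in iid_exp. E \<in> {E \<in> space iid_exp. ?Q E} \<longleftrightarrow> E \<in> (\<Union>\<tau>\<in>?T. sorted_by (h + k) \<tau>)"
      using AE_sorted_by[of "h + k"]
    proof eventually_elim
      case (elim E)
      then obtain \<tau> where t: "\<tau> permutes {1..h + k}" "E \<in> sorted_by (h + k) \<tau>" by blast
      have "E \<in> space iid_exp" using t(2) by (simp add: sorted_by_def)
      moreover have "\<tau> \<in> ?T" if "\<rho> \<in> ?T" "E \<in> sorted_by (h + k) \<rho>" for \<rho>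
        using iff[OF perm[OF that(1)] that(2)] iff[OF t] that(1) by blast
      ultimately show ?case using iff[OF t] t(2) by blast
    qed
    show "(\<Union>\<tau>\<in>?T. sorted_by (h + k) \<tau>) \<in> events"
      by (intro sets.finite_UN finite_overlap_perms sets_sorted_by perm)
    have coord: "(\<lambda>E. E (inv \<pi> j)) \<in> borel_measurable iid_exp" "(\<lambda>E. E (h + inv \<pi> j)) \<in> borel_measurable iid_exp"
      if "j \<in> {1..k}" for j
      using inpi[OF that] by (auto intro!: measurable_iid_exp_coord)
    show "{E \<in> space iid_exp. ?Q E} \<in> events"
      by (intro sets.sets_Collect_conj sets.sets_Collect_finite_All borel_measurable_less coord) auto
  qed
  also have "\<dots> = (\<Sum>\<tau>\<in>?T. prob (sorted_by (h + k) \<tau>))"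
  proof (rule finite_measure_finite_Union[OF finite_overlap_perms])
    show "sorted_by (h + k) ` ?T \<subseteq> events" using perm sets_sorted_by by blast
    show "disjoint_family_on (sorted_by (h + k)) ?T"
      by (rule disjoint_family_on_mono[OF _ disjoint_sorted_by]) (use perm in blast)
  qed
  also have "\<dots> = (\<Sum>\<tau>\<in>?T. 1 / fact (h + k))" by (intro sum.cong refl measure_sorted_by perm)
  finally show ?thesis by simp
qed

section \<open>Patterns of a Luce permutation on windows\<close>

lemma nth_elem_window: "j \<in> {1..m} \<Longrightarrow> nth_elem {i + 1..i + m} j = i + j"
  using sorted_list_of_set_range[of "i + 1" "Suc (i + m)"]
  by (simp add: nth_elem_def atLeastLessThanSuc_atLeastAtMost del: sorted_list_of_set_range upt_Suc)

lemma pat_window: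
  assumes "inj_on \<sigma> {i + 1..i + m}"
  shows "pat {i + 1..i + m} \<sigma> permutes {1..m}"
    and "\<And>a b. a \<in> {1..m} \<Longrightarrow> b \<in> {1..m} \<Longrightarrow>
      pat {i + 1..i + m} \<sigma> a < pat {i + 1..i + m} \<sigma> b \<longleftrightarrow> \<sigma> (i + a) < \<sigma> (i + b)"
proof -
  have card: "card {i + 1..i + m} = m" by simp
  have "pat {i + 1..i + m} \<sigma> permutes {1..m} \<and>
     (\<forall>a\<in>{1..m}. \<forall>b\<in>{1..m}. pat {i + 1..i + m} \<sigma> a < pat {i + 1..i + m} \<sigma> b \<longleftrightarrow>
        \<sigma> (nth_elem {i + 1..i + m} a) < \<sigma> (nth_elem {i + 1..i + m} b))"
    using theI'[OF ex1_pat[OF _ assms]] unfolding pat_def card by blast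
  then show "pat {i + 1..i + m} \<sigma> permutes {1..m}"
    and "\<And>a b. a \<in> {1..m} \<Longrightarrow> b \<in> {1..m} \<Longrightarrow>
      pat {i + 1..i + m} \<sigma> a < pat {i + 1..i + m} \<sigma> b \<longleftrightarrow> \<sigma> (i + a) < \<sigma> (i + b)"
    by (auto simp only: nth_elem_window)
qed

lemma pat_window_eq_iff:
  assumes inj: "inj_on \<sigma> {i + 1..i + m}" and tau: "\<tau> permutes {1..m}"
  shows "pat {i + 1..i + m} \<sigma> = \<tau> \<longleftrightarrow> (\<forall>j\<in>{1..<m}. \<sigma> (i + inv \<tau> j) < \<sigma> (i + inv \<tau> (j + 1)))"
proof -
  have "pat {i + 1..i + m} \<sigma> = \<tau> \<longleftrightarrow> (\<forall>a\<in>{1..m}. \<forall>b\<in>{1..m}. \<tau> a < \<tau> b \<longleftrightarrow> \<sigma> (i + a) < \<sigma> (i + b))"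
    using pat_window[OF inj] permutes_eqI_order[OF pat_window(1)[OF inj] tau] by auto
  also have "\<dots> \<longleftrightarrow> (\<forall>j\<in>{1..<m}. \<sigma> (i + inv \<tau> j) < \<sigma> (i + inv \<tau> (j + 1)))"
    by (rule less_iff_increasing_along_inverse[OF tau])
  finally show ?thesis .
qed

text \<open>
  The items in their order of arrival: \<open>\<sigma> j\<close> is the rank of item \<open>j\<close>, so the inverse of \<open>\<sigma>\<close> lists the
  items.
\<close>

definition order_list :: "nat \<Rightarrow> (nat \<Rightarrow> nat) \<Rightarrow> nat list" where
  "order_list n \<sigma> = map (inv \<sigma>) [1..<n + 1]"

lemma permutations_of_set_window:
  "\<tau> permutes {1..m} \<Longrightarrow> map (\<lambda>j. i + inv \<tau> j) [1..<m + 1] \<in> permutations_of_set {i + 1..i + m}"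
proof (rule permutations_of_setI)
  assume tau: "\<tau> permutes {1..m}"
  have inv: "inv \<tau> permutes {1..m}" using tau by (rule permutes_inv)
  have set: "set [1..<m + 1] = {1..m}" by (auto simp del: upt_Suc)
  have "set (map (\<lambda>j. i + inv \<tau> j) [1..<m + 1]) = (+) i ` inv \<tau> ` {1..m}"
    by (simp only: set_map set image_image)
  also have "\<dots> = {i + 1..i + m}"
    unfolding permutes_image[OF inv] using image_add_atLeastAtMost[of i 1 m] by (simp only: add.commute)
  finally show "set (map (\<lambda>j. i + inv \<tau> j) [1..<m + 1]) = {i + 1..i + m}" .
  have "inj (inv \<tau>)" using permutes_inj[OF inv] .
  then show "distinct (map (\<lambda>j. i + inv \<tau> j) [1..<m + 1])"
    by (simp add: distinct_map inj_on_def inj_def del: upt_Suc)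
qed

lemma bij_betw_order_list: "bij_betw (order_list n) {\<sigma>. \<sigma> permutes {1..n}} (permutations_of_set {1..n})"
proof -
  let ?S = "{\<sigma>. \<sigma> permutes {1..n}}"
  have inj: "inj_on (order_list n) ?S"
  proof (rule inj_onI)
    fix \<sigma> \<rho> assume s: "\<sigma> \<in> ?S" and r: "\<rho> \<in> ?S" and eq: "order_list n \<sigma> = order_list n \<rho>"
    have inv: "inv \<sigma> permutes {1..n}" "inv \<rho> permutes {1..n}" using s r by (auto intro: permutes_inv)
    have "inv \<sigma> j = inv \<rho> j" for j
    proof (cases "j \<in> {1..n}")
      case True
      then have "j \<in> set [1..<n + 1]" by (auto simp del: upt_Suc)
      then show ?thesis using eq unfolding order_list_def map_eq_conv by blast
    next
      case False
      then show ?thesis using inv by (simp add: permutes_not_in)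
    qed
    then have "inv (inv \<sigma>) = inv (inv \<rho>)" by presburger
    then show "\<sigma> = \<rho>" using s r by (simp add: permutes_inv_inv)
  qed
  moreover have "order_list n ` ?S = permutations_of_set {1..n}"
  proof (rule card_subset_eq)
    show "order_list n ` ?S \<subseteq> permutations_of_set {1..n}"
      using permutations_of_set_window[of _ n 0] by (auto simp: order_list_def)
    show "card (order_list n ` ?S) = card (permutations_of_set {1..n})"
      by (subst card_image[OF inj]) (simp add: card_permutations)
  qed simp
  ultimately show ?thesis by (simp add: bij_betw_def)
qed

text \<open>
  Both lists enumerate the window, and the restriction of the order of arrival is increasing in \<open>\<sigma>\<close>.
  They agree if and only if the right one is increasing as well, which is the condition for the
  pattern to be \<open>\<tau>\<close>.
\<close>

lemma pat_window_eq_iff_filter: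
  assumes sig: "\<sigma> permutes {1..n}" and win: "i + m \<le> n" and tau: "\<tau> permutes {1..m}"
  shows "pat {i + 1..i + m} \<sigma> = \<tau> \<longleftrightarrow>
    filter (\<lambda>x. x \<in> {i + 1..i + m}) (order_list n \<sigma>) = map (\<lambda>j. i + inv \<tau> j) [1..<m + 1]"
proof -
  let ?I = "{i + 1..i + m}" and ?L = "filter (\<lambda>x. x \<in> {i + 1..i + m}) (order_list n \<sigma>)"
    and ?R = "map (\<lambda>j. i + inv \<tau> j) [1..<m + 1]"
  have inj: "inj \<sigma>" using permutes_inj[OF sig] .
  have setR: "set ?R = ?I" using permutations_of_set_window[OF tau, of i] by (simp add: permutations_of_set_def)
  have "set (order_list n \<sigma>) = {1..n}"
    using permutations_of_set_window[OF sig, of 0] by (simp add: permutations_of_set_def order_list_def)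
  then have setL: "set ?L = ?I" using win by auto
  have "map \<sigma> (order_list n \<sigma>) = [1..<n + 1]"
    by (simp add: order_list_def o_def permutes_inverses(1)[OF sig] del: upt_Suc)
  then have "sorted_wrt (<) (map \<sigma> (order_list n \<sigma>))" by (simp only: sorted_wrt_upt)
  then have sortL: "sorted_wrt (<) (map \<sigma> ?L)"
    by (simp add: sorted_wrt_map sorted_wrt_filter)
  have "?L = ?R \<longleftrightarrow> map \<sigma> ?L = map \<sigma> ?R"
    by (rule inj_map_eq_map[OF inj, symmetric])
  also have "\<dots> \<longleftrightarrow> sorted_wrt (<) (map \<sigma> ?R)"
  proof
    assume "sorted_wrt (<) (map \<sigma> ?R)"
    then show "map \<sigma> ?L = map \<sigma> ?R"
      by (rule strict_sorted_equal[OF _ sortL]) (simp only: list.set_map[of \<sigma>] setL setR)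
  qed (use sortL in metis)
  also have "\<dots> \<longleftrightarrow> (\<forall>l. Suc l < m \<longrightarrow> \<sigma> (i + inv \<tau> (1 + l)) < \<sigma> (i + inv \<tau> (1 + Suc l)))"
    by (subst sorted_wrt_iff_nth_Suc_transp) (auto simp del: upt_Suc)
  also have "\<dots> \<longleftrightarrow> (\<forall>j\<in>{1..<m}. \<sigma> (i + inv \<tau> j) < \<sigma> (i + inv \<tau> (j + 1)))"
  proof (intro iffI ballI allI impI)
    fix j assume a: "\<forall>l. Suc l < m \<longrightarrow> \<sigma> (i + inv \<tau> (1 + l)) < \<sigma> (i + inv \<tau> (1 + Suc l))" and "j \<in> {1..<m}"
    then show "\<sigma> (i + inv \<tau> j) < \<sigma> (i + inv \<tau> (j + 1))" using a[rule_format, of "j - 1"] by auto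
  qed auto
  also have "\<dots> \<longleftrightarrow> pat ?I \<sigma> = \<tau>"
    using pat_window_eq_iff[OF _ tau, of \<sigma> i] inj by (simp add: inj_on_subset)
  finally show ?thesis ..
qed

lemma measure_order_list:
  assumes X: "luce_distributed M X n w"
  shows "measure M {\<omega> \<in> space M. P (order_list n (X \<omega>))} = luce_prob w {1..n} P"
proof -
  interpret prob_space M using X by (simp add: luce_distributed_def)
  let ?S = "{\<sigma>. \<sigma> permutes {1..n}}"
  have meas: "X \<in> measurable M (count_space ?S)"
    and pm: "\<And>\<sigma>. \<sigma> \<in> ?S \<Longrightarrow> prob {\<omega> \<in> space M. X \<omega> = \<sigma>} = luce_p n (\<lambda>j. w (inv \<sigma> j))"
    using X by (auto simp: luce_distributed_def)
  have fS: "finite ?S" by (rule finite_permutations) simp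
  let ?T = "{\<sigma> \<in> ?S. P (order_list n \<sigma>)}"
  have ev: "{\<omega> \<in> space M. X \<omega> = \<sigma>} \<in> events" if "\<sigma> \<in> ?S" for \<sigma>
  proof -
    have "X -` {\<sigma>} \<inter> space M \<in> events" using that by (intro measurable_sets[OF meas]) auto
    also have "X -` {\<sigma>} \<inter> space M = {\<omega> \<in> space M. X \<omega> = \<sigma>}" by auto
    finally show ?thesis .
  qed
  have "{\<omega> \<in> space M. P (order_list n (X \<omega>))} = (\<Union>\<sigma>\<in>?T. {\<omega> \<in> space M. X \<omega> = \<sigma>})"
    using measurable_space[OF meas] by auto
  also have "prob \<dots> = (\<Sum>\<sigma>\<in>?T. prob {\<omega> \<in> space M. X \<omega> = \<sigma>})"
    using fS ev by (intro finite_measure_finite_Union) (auto simp: disjoint_family_on_def)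
  also have "\<dots> = (\<Sum>\<sigma>\<in>?T. luce_list w (order_list n \<sigma>))"
    using pm by (intro sum.cong) (auto simp: luce_p_eq_luce_list order_list_def)
  also have "\<dots> = (\<Sum>l\<in>order_list n ` ?T. luce_list w l)"
    using bij_betw_order_list[of n]
    by (subst sum.reindex) (auto simp: bij_betw_def intro: inj_on_subset)
  also have "order_list n ` ?T = {l \<in> permutations_of_set {1..n}. P l}"
    using bij_betw_order_list[of n] unfolding bij_betw_def by auto
  finally show ?thesis by (simp add: luce_prob_def)
qed

context
  fixes M :: "'w measure" and X :: "'w \<Rightarrow> nat \<Rightarrow> nat" and n :: nat and w :: "nat \<Rightarrow> real"
  assumes X: "luce_distributed M X n w" and pos: "\<And>j. j \<in> {1..n} \<Longrightarrow> w j > 0"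
begin

lemma luce_permutes: "\<omega> \<in> space M \<Longrightarrow> X \<omega> permutes {1..n}"
  using X measurable_space[of X M "count_space {\<sigma>. \<sigma> permutes {1..n}}"] by (auto simp: luce_distributed_def)

lemma luce_event: "{\<omega> \<in> space M. Q (X \<omega>)} \<in> sets M"
proof -
  have "X -` {\<sigma> \<in> {\<sigma>. \<sigma> permutes {1..n}}. Q \<sigma>} \<inter> space M \<in> sets M"
    using X by (intro measurable_sets[of X M "count_space {\<sigma>. \<sigma> permutes {1..n}}"]) (auto simp: luce_distributed_def)
  also have "X -` {\<sigma> \<in> {\<sigma>. \<sigma> permutes {1..n}}. Q \<sigma>} \<inter> space M = {\<omega> \<in> space M. Q (X \<omega>)}"
    using luce_permutes by auto
  finally show ?thesis .
qed

lemma prob_pat: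
  assumes "i + m \<le> n" "\<tau> permutes {1..m}"
  shows "measure M {\<omega> \<in> space M. pat {i + 1..i + m} (X \<omega>) = \<tau>} = luce_p m (\<lambda>j. w (i + inv \<tau> j))"
proof -
  have sub: "{i + 1..i + m} \<subseteq> {1..n}" using assms(1) by auto
  have eq: "{\<omega> \<in> space M. pat {i + 1..i + m} (X \<omega>) = \<tau>} =
    {\<omega> \<in> space M. filter (\<lambda>x. x \<in> {i + 1..i + m}) (order_list n (X \<omega>)) = map (\<lambda>j. i + inv \<tau> j) [1..<m + 1]}"
    using pat_window_eq_iff_filter[OF luce_permutes assms] by blast
  have "measure M {\<omega> \<in> space M. pat {i + 1..i + m} (X \<omega>) = \<tau>} = luce_prob w {1..n}
      (\<lambda>l. filter (\<lambda>x. x \<in> {i + 1..i + m}) l = map (\<lambda>j. i + inv \<tau> j) [1..<m + 1])"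
    unfolding eq by (rule measure_order_list[OF X])
  also have "\<dots> = luce_list w (map (\<lambda>j. i + inv \<tau> j) [1..<m + 1])"
    by (rule luce_prob_filter[OF finite_atLeastAtMost sub permutations_of_set_window[OF assms(2)]]) (rule pos)
  also have "\<dots> = luce_p m (\<lambda>j. w (i + inv \<tau> j))"
    by (rule luce_p_eq_luce_list [symmetric])
  finally show ?thesis .
qed

lemma prob_pat_disjoint:
  assumes "i + m \<le> i'" "i' + m' \<le> n" "\<tau> permutes {1..m}" "\<tau>' permutes {1..m'}"
  shows "measure M {\<omega> \<in> space M. pat {i + 1..i + m} (X \<omega>) = \<tau> \<and> pat {i' + 1..i' + m'} (X \<omega>) = \<tau>'}
    = luce_p m (\<lambda>j. w (i + inv \<tau> j)) * luce_p m' (\<lambda>j. w (i' + inv \<tau>' j))"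
proof -
  have le: "i + m \<le> n" using assms by linarith
  have sub: "{i + 1..i + m} \<subseteq> {1..n}" "{i' + 1..i' + m'} \<subseteq> {1..n}"
    "{i + 1..i + m} \<inter> {i' + 1..i' + m'} = {}"
    using le assms(1,2) by auto
  have eq: "{\<omega> \<in> space M. pat {i + 1..i + m} (X \<omega>) = \<tau> \<and> pat {i' + 1..i' + m'} (X \<omega>) = \<tau>'} =
    {\<omega> \<in> space M. filter (\<lambda>x. x \<in> {i + 1..i + m}) (order_list n (X \<omega>)) = map (\<lambda>j. i + inv \<tau> j) [1..<m + 1]
       \<and> filter (\<lambda>x. x \<in> {i' + 1..i' + m'}) (order_list n (X \<omega>)) = map (\<lambda>j. i' + inv \<tau>' j) [1..<m' + 1]}"
    using pat_window_eq_iff_filter[OF luce_permutes le assms(3)]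
      pat_window_eq_iff_filter[OF luce_permutes assms(2,4)] by blast
  have "measure M {\<omega> \<in> space M. pat {i + 1..i + m} (X \<omega>) = \<tau> \<and> pat {i' + 1..i' + m'} (X \<omega>) = \<tau>'}
    = luce_prob w {1..n}
      (\<lambda>l. filter (\<lambda>x. x \<in> {i + 1..i + m}) l = map (\<lambda>j. i + inv \<tau> j) [1..<m + 1]
         \<and> filter (\<lambda>x. x \<in> {i' + 1..i' + m'}) l = map (\<lambda>j. i' + inv \<tau>' j) [1..<m' + 1])"
    unfolding eq by (rule measure_order_list[OF X])
  also have "\<dots> = luce_list w (map (\<lambda>j. i + inv \<tau> j) [1..<m + 1]) * luce_list w (map (\<lambda>j. i' + inv \<tau>' j) [1..<m' + 1])"
    by (rule luce_prob_filter_disjoint[OF finite_atLeastAtMost sub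
          permutations_of_set_window[OF assms(3)] permutations_of_set_window[OF assms(4)]]) (rule pos)
  also have "\<dots> = luce_p m (\<lambda>j. w (i + inv \<tau> j)) * luce_p m' (\<lambda>j. w (i' + inv \<tau>' j))"
    by (intro arg_cong2[of _ _ _ _ "(*)"] luce_p_eq_luce_list [symmetric])
  finally show ?thesis .
qed

text \<open>
  Two overlapping windows are contained in one window of length \<open>h + k\<close>, whose pattern decides
  whether \<open>\<pi>\<close> occurs at both places.
\<close>

lemma prob_pat_overlap:
  assumes "i + h + k \<le> n" and pi: "\<pi> permutes {1..k}"
  shows "measure M {\<omega> \<in> space M. pat {i + 1..i + k} (X \<omega>) = \<pi> \<and> pat {i + h + 1..i + h + k} (X \<omega>) = \<pi>}
    = (\<Sum>\<tau>\<in>overlap_perms k \<pi> h. luce_p (h + k) (\<lambda>j. w (i + inv \<tau> j)))"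
proof -
  interpret prob_space M using X by (simp add: luce_distributed_def)
  let ?T = "overlap_perms k \<pi> h"
  have perm: "\<tau> permutes {1..h + k}" if "\<tau> \<in> ?T" for \<tau> using that by (simp add: overlap_perms_def)
  have inpi: "inv \<pi> j \<in> {1..k}" if "j \<in> {1..k}" for j
    using that permutes_in_image[OF permutes_inv[OF pi]] by blast
  have iff: "pat {i + 1..i + k} \<sigma> = \<pi> \<and> pat {i + h + 1..i + h + k} \<sigma> = \<pi> \<longleftrightarrow> pat {i + 1..i + (h + k)} \<sigma> \<in> ?T"
    if sig: "\<sigma> permutes {1..n}" for \<sigma>
  proof -
    have inj: "inj_on \<sigma> A" for A using permutes_inj[OF sig] by (rule inj_on_subset) simp
    let ?\<tau> = "pat {i + 1..i + (h + k)} \<sigma>"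
    have "?\<tau> (inv \<pi> j) < ?\<tau> (inv \<pi> (j + 1)) \<longleftrightarrow> \<sigma> (i + inv \<pi> j) < \<sigma> (i + inv \<pi> (j + 1))"
      "?\<tau> (h + inv \<pi> j) < ?\<tau> (h + inv \<pi> (j + 1)) \<longleftrightarrow> \<sigma> (i + h + inv \<pi> j) < \<sigma> (i + h + inv \<pi> (j + 1))"
      if "j \<in> {1..<k}" for j
      using inpi[of j] inpi[of "j + 1"] that by (subst pat_window(2)[OF inj]; simp add: add.assoc)+
    then show ?thesis
      unfolding pat_window_eq_iff[OF inj pi] overlap_perms_def mem_Collect_eq
      using pat_window(1)[OF inj, of i "h + k"] by simp
  qed
  have eq: "{\<omega> \<in> space M. pat {i + 1..i + k} (X \<omega>) = \<pi> \<and> pat {i + h + 1..i + h + k} (X \<omega>) = \<pi>} =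
    (\<Union>\<tau>\<in>?T. {\<omega> \<in> space M. pat {i + 1..i + (h + k)} (X \<omega>) = \<tau>})"
    using iff[OF luce_permutes] by blast
  have "prob {\<omega> \<in> space M. pat {i + 1..i + k} (X \<omega>) = \<pi> \<and> pat {i + h + 1..i + h + k} (X \<omega>) = \<pi>}
     = (\<Sum>\<tau>\<in>?T. prob {\<omega> \<in> space M. pat {i + 1..i + (h + k)} (X \<omega>) = \<tau>})"
    unfolding eq
  proof (rule finite_measure_finite_Union[OF finite_overlap_perms])
    show "(\<lambda>\<tau>. {\<omega> \<in> space M. pat {i + 1..i + (h + k)} (X \<omega>) = \<tau>}) ` ?T \<subseteq> events"
      by (intro image_subsetI luce_event)
  qed (auto simp: disjoint_family_on_def)
  also have "\<dots> = (\<Sum>\<tau>\<in>?T. luce_p (h + k) (\<lambda>j. w (i + inv \<tau> j)))"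
    using assms(1) by (intro sum.cong refl prob_pat perm) auto
  finally show ?thesis .
qed

end

section \<open>Slow variation of the weights\<close>

text \<open>
  Almost everywhere convergence on the unit interval implies convergence in measure, by dominated
  convergence of the indicators.
\<close>

lemma measure_deviation_tendsto_0:
  fixes g :: "nat \<Rightarrow> real \<Rightarrow> real"
  assumes [measurable]: "\<And>n. g n \<in> borel_measurable (lebesgue_on {0..1})" "h \<in> borel_measurable (lebesgue_on {0..1})"
    and lim: "AE y in lebesgue_on {0..1}. (\<lambda>n. g n y) \<longlonglongrightarrow> h y" and e: "e > 0"
  shows "(\<lambda>n. measure lebesgue {y \<in> {0..1}. \<bar>g n y - h y\<bar> > e}) \<longlonglongrightarrow> 0"
proof -
  let ?M = "lebesgue_on {0..1::real}"
  interpret finite_measure ?M by (rule finite_measure_lebesgue_on) auto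
  let ?A = "\<lambda>n. {y \<in> space ?M. \<bar>g n y - h y\<bar> > e}"
  have "(\<lambda>n. integral\<^sup>L ?M (indicator (?A n) :: real \<Rightarrow> real)) \<longlonglongrightarrow> integral\<^sup>L ?M (\<lambda>_. 0)"
  proof (rule integral_dominated_convergence[where w = "\<lambda>_. 1"])
    show "AE y in ?M. (\<lambda>n. indicator (?A n) y :: real) \<longlonglongrightarrow> 0"
      using lim
    proof eventually_elim
      case (elim y)
      then have "eventually (\<lambda>n. \<bar>g n y - h y\<bar> < e) sequentially"
        using e by (simp add: tendsto_iff dist_real_def)
      then have "eventually (\<lambda>n. indicator (?A n) y = (0::real)) sequentially"
        by eventually_elim (auto simp: indicator_def)
      then show ?case by (rule tendsto_eventually)
    qed
  next
    show "indicator (?A n) \<in> borel_measurable ?M" for n by measurable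
  qed auto
  moreover have "integral\<^sup>L ?M (indicator (?A n) :: real \<Rightarrow> real) = measure lebesgue {y \<in> {0..1}. \<bar>g n y - h y\<bar> > e}" for n
  proof -
    let ?S = "{y \<in> {0..1}. \<bar>g n y - h y\<bar> > e}"
    have "integral\<^sup>L ?M (indicator (?A n) :: real \<Rightarrow> real) = measure ?M (?A n \<inter> space ?M)"
      by (rule Bochner_Integration.integral_indicator)
    also have "?A n \<inter> space ?M = ?S" by (simp only: space_lebesgue_on) blast
    also have "measure ?M ?S = measure lebesgue ?S"
    proof (rule measure_restrict_space)
      show "?S \<subseteq> {0..1}" by blast
    qed simp
    finally show ?thesis .
  qed
  ultimately show ?thesis by simp
qed

lemma step_fun_measurable [measurable]: "step_fun n w \<in> borel_measurable (lebesgue_on {0..1})"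
proof -
  have "step_fun n w = (\<lambda>i. w (max 1 (nat i))) \<circ> (\<lambda>y. \<lfloor>y * real n\<rfloor>)" by (auto simp: step_fun_def)
  moreover have "(\<lambda>i. w (max 1 (nat i))) \<circ> (\<lambda>y. \<lfloor>y * real n\<rfloor>) \<in> borel_measurable borel"
    by measurable
  ultimately have "step_fun n w \<in> borel_measurable borel" by simp
  then have "step_fun n w \<in> borel_measurable lebesgue"
    by (simp add: measurable_completion)
  then show ?thesis by (rule measurable_restrict_space1)
qed

text \<open>
  The steps at which the logarithm of the weights jumps. Logarithms are the right scale because
  \<open>luce_p\<close> depends on the ratios of the weights only.
\<close>

definition rough :: "(nat \<Rightarrow> real) \<Rightarrow> nat \<Rightarrow> real \<Rightarrow> nat set" where
  "rough w n e = {i \<in> {1..<n}. \<bar>ln (w (Suc i)) - ln (w i)\<bar> > e}"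

text \<open>
  Off a set \<open>B\<close> of small measure, the logarithm of the step function is within \<open>2 * d\<close> of a uniformly
  continuous function \<open>G\<close>. If step \<open>i\<close> is rough, then for every \<open>y\<close> in the cell \<open>[i/n, (i+1)/n)\<close> one
  of the points \<open>y\<close> and \<open>y + 1/n\<close> lies in \<open>B\<close>. So the cells of the rough steps are covered by \<open>B\<close> and
  its translate by \<open>-1/n\<close>, and each of these disjoint cells has length \<open>1/n\<close>.
\<close>

lemma few_rough_steps:
  fixes \<theta> :: "nat \<Rightarrow> nat \<Rightarrow> real"
  assumes theta_pos: "\<And>n i. n \<ge> 1 \<Longrightarrow> i \<in> {1..n} \<Longrightarrow> \<theta> n i > 0"
    and f_meas: "f \<in> borel_measurable (lebesgue_on {0..1})"
    and f_pos: "\<And>y. y \<in> {0..1} \<Longrightarrow> f y > 0"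
    and conv: "AE y in lebesgue_on {0..1}. (\<lambda>n. step_fun n (\<theta> n) y) \<longlonglongrightarrow> f y"
    and e: "e > 0"
  shows "(\<lambda>n. real (card (rough (\<theta> n) n e)) / real n) \<longlonglongrightarrow> 0"
proof -
  \<comment> \<open>Two errors of size d at either end and one for the oscillation of G add up to 5 * d.\<close>
  define d where "d = e / 5"
  have d: "d > 0" using e by (simp add: d_def)
  let ?M = "lebesgue_on {0..1::real}"
  define H where "H = (\<lambda>y. ln (f y))"
  define F where "F = (\<lambda>n y. ln (step_fun n (\<theta> n) y))"
  have Hm [measurable]: "H \<in> borel_measurable ?M" unfolding H_def using f_meas by measurable
  have Fm [measurable]: "F n \<in> borel_measurable ?M" for n unfolding F_def by measurable
  have AE01: "AE y in ?M. y \<in> {0..1}" by (rule AE_I2) simp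
  have FH: "AE y in ?M. (\<lambda>n. F n y) \<longlonglongrightarrow> H y"
    using conv AE01
  proof eventually_elim
    case (elim y)
    show ?case unfolding F_def H_def
      using elim f_pos[of y] by (intro tendsto_ln) auto
  qed
  \<comment> \<open>Two exceptional sets of measure r and their translates, and one more step at the right end.\<close>
  have small: "eventually (\<lambda>n. real (card (rough (\<theta> n) n e)) / real n \<le> 4 * r + 1 / real n) sequentially"
    if r: "r > 0" for r
  proof -
    have "H measurable_on {0..1}" using Hm by (simp add: measurable_on_iff_borel_measurable)
    then obtain N G where N: "negligible N" and G: "\<And>j. continuous_on UNIV (G j)"
      and GH: "\<And>y. y \<notin> N \<Longrightarrow> (\<lambda>j. G j y) \<longlonglongrightarrow> (if y \<in> {0..1} then H y else 0)"
      unfolding measurable_on_def by blast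
    have Gm: "G j \<in> borel_measurable ?M" for j
      using G[of j] by (intro measurable_restrict_space1 measurable_completion) (simp add: borel_measurable_continuous_onI)
    have "AE y in lebesgue. y \<notin> N"
      using N by (simp add: negligible_iff_null_sets AE_not_in)
    then have "AE y in ?M. y \<notin> N" by (auto simp: AE_restrict_space_iff)
    then have "AE y in ?M. (\<lambda>j. G j y) \<longlonglongrightarrow> H y"
      using AE01 by eventually_elim (use GH in fastforce)
    then have "(\<lambda>j. measure lebesgue {y \<in> {0..1}. \<bar>G j y - H y\<bar> > d}) \<longlonglongrightarrow> 0"
      by (intro measure_deviation_tendsto_0 Gm Hm d)
    then have "eventually (\<lambda>j. measure lebesgue {y \<in> {0..1}. \<bar>G j y - H y\<bar> > d} < r) sequentially"
      using r by (rule order_tendstoD(2))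
    then obtain j where j: "measure lebesgue {y \<in> {0..1}. \<bar>G j y - H y\<bar> > d} < r"
      using eventually_happens'[OF sequentially_bot] by blast
    have "uniformly_continuous_on {0..1} (G j)"
      using G[of j] by (intro compact_uniformly_continuous) (auto intro: continuous_on_subset)
    then obtain s where s: "s > 0"
      "\<forall>x\<in>{0..1}. \<forall>y\<in>{0..1}. dist y x < s \<longrightarrow> dist (G j y) (G j x) < d"
      using d unfolding uniformly_continuous_on_def by blast
    have ev1: "eventually (\<lambda>n. measure lebesgue {y \<in> {0..1}. \<bar>F n y - H y\<bar> > d} < r) sequentially"
      by (rule order_tendstoD(2)[OF measure_deviation_tendsto_0[OF Fm Hm FH d] r])
    have ev2: "eventually (\<lambda>n. 1 / real n < s) sequentially"
      by (rule order_tendstoD(2)[OF lim_1_over_n s(1)])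
    show ?thesis
      using ev1 ev2 eventually_gt_at_top[of 0]
    proof eventually_elim
      case (elim n)
      define B where "B = {y \<in> {0..1}. \<bar>F n y - H y\<bar> > d} \<union> {y \<in> {0..1}. \<bar>G j y - H y\<bar> > d}"
      have meas: "{y \<in> {0..1}. \<bar>g y - H y\<bar> > d} \<in> lmeasurable"
        if [measurable]: "g \<in> borel_measurable ?M" for g
      proof -
        have "{y \<in> space ?M. \<bar>g y - H y\<bar> > d} \<in> sets ?M" by measurable
        then have "{y \<in> {0..1}. \<bar>g y - H y\<bar> > d} \<in> sets lebesgue"
          by (subst (asm) sets_restrict_space_iff) simp_all
        moreover have "bounded {y \<in> {0..1}. \<bar>g y - H y\<bar> > d}"
          by (rule bounded_subset[OF bounded_closed_interval[of 0 1]]) blast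
        ultimately show ?thesis by (simp add: bounded_set_imp_lmeasurable)
      qed
      have BL: "B \<in> lmeasurable" unfolding B_def by (intro fmeasurable.Un meas Fm Gm)
      have "measure lebesgue B \<le> measure lebesgue {y \<in> {0..1}. \<bar>F n y - H y\<bar> > d}
          + measure lebesgue {y \<in> {0..1}. \<bar>G j y - H y\<bar> > d}"
        unfolding B_def by (intro measure_Un_le fmeasurableD meas Fm Gm)
      then have mB: "measure lebesgue B < 2 * r" using elim(1) j by linarith
      define B' where "B' = (\<lambda>y. - 1 / real n + y) ` B"
      have B'L: "B' \<in> lmeasurable" unfolding B'_def using BL by (rule measurable_translation)
      have mB': "measure lebesgue B' = measure lebesgue B"
        unfolding B'_def by (rule measure_translation)
      define cell where "cell = (\<lambda>i::nat. {real i / real n ..< real (Suc i) / real n})"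
      \<comment> \<open>For \<open>n > 1\<close> the step function takes the value \<open>\<theta> n n\<close> at the single point 1 only, so the last
          step is not visible in measure and is counted separately.\<close>
      define R where "R = rough (\<theta> n) n e - {n - 1}"
      have Fcell: "F n y = ln (\<theta> n i)" if "y \<in> cell i" "i \<ge> 1" for y i
      proof -
        have "real i \<le> y * real n" "y * real n < real (Suc i)"
          using that elim(3) by (auto simp: cell_def field_simps)
        then have "\<lfloor>y * real n\<rfloor> = int i" by linarith
        then show ?thesis using that by (simp add: F_def step_fun_def max_def)
      qed
      have sub: "cell i \<subseteq> B \<union> B'" if i: "i \<in> R" for i
      proof
        fix y assume y: "y \<in> cell i"
        have i': "i \<ge> 1" "Suc (Suc i) \<le> n" "\<bar>ln (\<theta> n (Suc i)) - ln (\<theta> n i)\<bar> > e"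
          using i by (auto simp: R_def rough_def)
        define z where "z = y + 1 / real n"
        have z: "z \<in> cell (Suc i)" using y by (auto simp: z_def cell_def add_divide_distrib)
        have "real (Suc (Suc i)) \<le> real n" using i'(2) by linarith
        then have "real (Suc (Suc i)) / real n \<le> 1" using elim(3) by simp
        then have "z \<le> 1" using z by (simp add: cell_def del: of_nat_Suc)
        moreover have "0 \<le> real i / real n" "0 \<le> 1 / real n" by simp_all
        then have "0 \<le> y" "y \<le> z"
          using y unfolding cell_def z_def atLeastLessThan_iff by linarith+
        ultimately have z01: "z \<in> {0..1}" and y01: "y \<in> {0..1}" by auto
        show "y \<in> B \<union> B'"
        proof (rule ccontr)
          assume "y \<notin> B \<union> B'"
          then have "y \<notin> B" "z \<notin> B" by (auto simp: B'_def z_def image_iff)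
          then have "\<bar>F n y - H y\<bar> \<le> d" "\<bar>G j y - H y\<bar> \<le> d" "\<bar>F n z - H z\<bar> \<le> d" "\<bar>G j z - H z\<bar> \<le> d"
            using y01 z01 by (auto simp: B_def)
          moreover have "\<bar>G j z - G j y\<bar> < d"
            using s(2) y01 z01 elim(2) by (auto simp: z_def dist_real_def)
          ultimately have "\<bar>F n z - F n y\<bar> < 5 * d" by linarith
          then show False using Fcell[OF y i'(1)] Fcell[OF z] i'(3) by (simp add: d_def)
        qed
      qed
      have fR: "finite R" by (simp add: R_def rough_def)
      have disj: "disjoint_family_on cell R"
      proof (unfold disjoint_family_on_def, intro ballI impI)
        fix a b :: nat assume "a \<noteq> b"
        have "real (Suc u) / real n \<le> real v / real n" if "u < v" for u v :: nat
          using that by (intro divide_right_mono) auto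
        then have "cell u \<inter> cell v = {}" if "u < v" for u v :: nat
          using that unfolding cell_def
          by (metis Int_commute disjoint_iff atLeastLessThan_iff leD order_less_le_trans)
        with \<open>a \<noteq> b\<close> show "cell a \<inter> cell b = {}"
          by (metis Int_commute linorder_neqE_nat)
      qed
      have "real (card R) / real n = (\<Sum>i\<in>R. measure lebesgue (cell i))"
      proof -
        have "measure lebesgue (cell i) = 1 / real n" for i
        proof -
          have "real i / real n \<le> real (Suc i) / real n" by (intro divide_right_mono) auto
          then have "measure lebesgue (cell i) = real (Suc i) / real n - real i / real n"
            by (simp add: cell_def del: of_nat_Suc)
          then show ?thesis by (simp add: diff_divide_distrib [symmetric])
        qed
        then show ?thesis by simp
      qed
      also have "\<dots> = measure lebesgue (\<Union>i\<in>R. cell i)"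
      proof (rule measure_finite_Union [symmetric, OF fR _ disj])
        have L: "cell i \<in> lmeasurable" for i
          unfolding cell_def by (rule bounded_set_imp_lmeasurable) auto
        show "cell ` R \<subseteq> sets lebesgue" using L fmeasurableD by blast
        show "emeasure lebesgue (cell i) \<noteq> \<infinity>" for i
          using fmeasurableD2[OF L] by simp
      qed
      also have "\<dots> \<le> measure lebesgue (B \<union> B')"
        using BL B'L by (intro measure_mono_fmeasurable UN_least sub fmeasurable.Un)
          (auto simp: cell_def)
      also have "\<dots> \<le> measure lebesgue B + measure lebesgue B'"
        using BL B'L by (intro measure_Un_le fmeasurableD)
      also have "\<dots> \<le> 4 * r" using mB mB' by simp
      finally have 1: "real (card R) / real n \<le> 4 * r" .
      have "card (rough (\<theta> n) n e) \<le> card (insert (n - 1) R)"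
        using fR by (intro card_mono) (auto simp: R_def)
      also have "\<dots> \<le> card R + 1" using fR by (simp add: card_insert_if)
      finally have "real (card (rough (\<theta> n) n e)) / real n \<le> (real (card R) + 1) / real n"
        by (intro divide_right_mono) auto
      then show ?case using 1 by (simp add: add_divide_distrib)
    qed
  qed
  show ?thesis
  proof (rule tendstoI)
    fix r :: real assume r: "r > 0"
    have "eventually (\<lambda>n. 1 / real n < r / 2) sequentially"
      using r by (intro order_tendstoD(2)[OF lim_1_over_n]) simp
    moreover have "eventually (\<lambda>n. real (card (rough (\<theta> n) n e)) / real n \<le> 4 * (r / 8) + 1 / real n) sequentially"
      using r by (intro small) simp
    ultimately show "eventually (\<lambda>n. dist (real (card (rough (\<theta> n) n e)) / real n) 0 < r) sequentially"
    proof (eventually_elim)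
      case (elim n)
      then show ?case by simp
    qed
  qed
qed

section \<open>Averages over windows\<close>

lemma sum_remaining:
  fixes x :: "nat \<Rightarrow> real"
  assumes "j \<in> {1..m}"
  shows "(\<Sum>l=1..m. x l) - (\<Sum>l=1..<j. x l) = (\<Sum>l=j..m. x l)"
proof -
  have "{1..m} = {1..<j} \<union> {j..m}" using assms by auto
  moreover have "sum x ({1..<j} \<union> {j..m}) = sum x {1..<j} + sum x {j..m}"
    by (rule sum.union_disjoint) auto
  ultimately show ?thesis by simp
qed

lemma luce_p_bounds:
  assumes "\<And>j. j \<in> {1..m} \<Longrightarrow> x j > 0"
  shows "0 \<le> luce_p m x" "luce_p m x \<le> 1"
proof -
  have "0 \<le> x j / ((\<Sum>l=1..m. x l) - (\<Sum>l=1..<j. x l)) \<and> x j / ((\<Sum>l=1..m. x l) - (\<Sum>l=1..<j. x l)) \<le> 1"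
    if j: "j \<in> {1..m}" for j
  proof -
    have "x j \<le> (\<Sum>l=j..m. x l)"
      using assms j by (intro member_le_sum) (auto intro: less_imp_le)
    then show ?thesis using assms[OF j] unfolding sum_remaining[OF j] by (simp add: divide_simps)
  qed
  then show "0 \<le> luce_p m x" "luce_p m x \<le> 1"
    unfolding luce_p_def by (auto intro!: prod_nonneg prod_le_1)
qed

text \<open>
  If all weights agree up to a factor \<open>exp d\<close>, then the \<open>j\<close>-th factor of \<open>luce_p\<close> agrees up to that
  factor with its value \<open>1 / (m + 1 - j)\<close> for equal weights.
\<close>

lemma luce_p_near_uniform:
  assumes pos: "\<And>j. j \<in> {1..m} \<Longrightarrow> x j > 0" and d: "d \<ge> 0"
    and near: "\<And>i j. i \<in> {1..m} \<Longrightarrow> j \<in> {1..m} \<Longrightarrow> x i \<le> exp d * x j"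
  shows "\<bar>luce_p m x - 1 / fact m\<bar> \<le> exp (real m * d) - 1"
proof -
  let ?r = "\<lambda>j. x j / ((\<Sum>l=1..m. x l) - (\<Sum>l=1..<j. x l))"
  have r: "exp (- d) / real (m + 1 - j) \<le> ?r j \<and> ?r j \<le> exp d / real (m + 1 - j)"
    if j: "j \<in> {1..m}" for j
  proof -
    define D where "D = (\<Sum>l=j..m. x l)"
    have D: "(\<Sum>l=1..m. x l) - (\<Sum>l=1..<j. x l) = D"
      unfolding D_def by (rule sum_remaining[OF j])
    define N where "N = real (m + 1 - j)"
    have N: "N > 0" using j by (simp add: N_def)
    have "D \<le> (\<Sum>l=j..m. exp d * x j)"
      unfolding D_def using j by (intro sum_mono near) auto
    then have 1: "D \<le> N * (exp d * x j)" by (simp add: N_def)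
    have "(\<Sum>l=j..m. exp (- d) * x j) \<le> D"
      unfolding D_def
    proof (rule sum_mono)
      fix l assume "l \<in> {j..m}"
      then have "x j \<le> exp d * x l" using j by (intro near) auto
      then have "exp (- d) * x j \<le> exp (- d) * (exp d * x l)" by (intro mult_left_mono) auto
      then show "exp (- d) * x j \<le> x l" by (simp add: mult.assoc[symmetric] exp_add[symmetric])
    qed
    then have 2: "N * (exp (- d) * x j) \<le> D" by (simp add: N_def)
    have xj: "x j > 0" using pos[OF j] .
    have "0 < N * (exp (- d) * x j)" using N xj by simp
    then have Dp: "D > 0" using 2 by linarith
    have "exp d * D \<ge> exp d * (N * (exp (- d) * x j))" using 2 by (intro mult_left_mono) auto
    also have "exp d * (N * (exp (- d) * x j)) = (exp d * exp (- d)) * (N * x j)" by (simp only: ac_simps)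
    also have "exp d * exp (- d) = 1" by (simp add: exp_add[symmetric])
    finally have "exp d * D \<ge> N * x j" by simp
    then have u: "x j / D \<le> exp d / N" using N Dp by (simp add: divide_simps mult.commute)
    have "exp (- d) * D \<le> exp (- d) * (N * (exp d * x j))" using 1 by (intro mult_left_mono) auto
    also have "exp (- d) * (N * (exp d * x j)) = (exp d * exp (- d)) * (N * x j)" by (simp only: ac_simps)
    also have "exp d * exp (- d) = 1" by (simp add: exp_add[symmetric])
    finally have "exp (- d) * D \<le> N * x j" by simp
    then have "exp (- d) / N \<le> x j / D" using N Dp by (simp add: divide_simps mult.commute)
    with u show ?thesis unfolding D N_def by simp
  qed
  have f: "(\<Prod>j=1..m. real (m + 1 - j)) = fact m"
    using prod.atLeastAtMost_rev[of real 1 m] by (simp add: fact_prod)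
  have "luce_p m x \<le> (\<Prod>j=1..m. exp d / real (m + 1 - j))"
    unfolding luce_p_def
  proof (intro prod_mono conjI)
    fix j assume j: "j \<in> {1..m}"
    have "0 \<le> exp (- d) / real (m + 1 - j)" by simp
    then show "0 \<le> ?r j" using r[OF j] by (meson order_trans)
    show "?r j \<le> exp d / real (m + 1 - j)" using r[OF j] by simp
  qed
  then have up: "luce_p m x \<le> exp (real m * d) / fact m"
    by (simp only: prod_dividef f) (simp add: exp_of_nat_mult)
  have "(\<Prod>j=1..m. exp (- d) / real (m + 1 - j)) \<le> luce_p m x"
    unfolding luce_p_def using r by (intro prod_mono conjI) auto
  then have lo: "exp (- (real m * d)) / fact m \<le> luce_p m x"
    using exp_of_nat_mult[of m "- d"] by (simp only: prod_dividef f) simp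
  let ?E = "exp (real m * d)"
  have E: "?E \<ge> 1" using d by simp
  have fa: "(fact m :: real) \<ge> 1" by (rule fact_ge_1)
  have "(?E - 1) / fact m \<le> (?E - 1) / 1" using E fa by (intro divide_left_mono) auto
  moreover have "(1 - exp (- (real m * d))) / fact m \<le> (1 - exp (- (real m * d))) / 1"
    using fa d by (intro divide_left_mono) auto
  moreover have "1 - exp (- (real m * d)) \<le> ?E - 1"
    using E exp_minus_ge[of "- (real m * d)"] exp_ge_add_one_self[of "real m * d"] exp_ge_add_one_self[of "- (real m * d)"] by linarith
  ultimately show ?thesis using up lo by (simp add: diff_divide_distrib abs_le_iff)
qed

lemma ln_drift_le:
  assumes "{p..<p + q} \<subseteq> {1..<n}" "{p..<p + q} \<inter> rough w n e = {}"
  shows "\<bar>ln (w (p + q)) - ln (w p)\<bar> \<le> real q * e"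
  using assms
proof (induction q)
  case (Suc q)
  have "p + q \<in> {p..<p + Suc q}" by simp
  then have "p + q \<in> {1..<n}" "p + q \<notin> rough w n e" using Suc.prems by blast+
  then have "\<bar>ln (w (Suc (p + q))) - ln (w (p + q))\<bar> \<le> e" by (auto simp: rough_def)
  moreover have "\<bar>ln (w (p + q)) - ln (w p)\<bar> \<le> real q * e" 
  proof (rule Suc.IH)
    have "{p..<p + q} \<subseteq> {p..<p + Suc q}" by auto
    then show "{p..<p + q} \<subseteq> {1..<n}" "{p..<p + q} \<inter> rough w n e = {}" using Suc.prems by blast+
  qed
  ultimately show ?case by (simp add: algebra_simps)
qed simp

text \<open>
  There are \<open>n + 1 - m\<close> windows of length \<open>m\<close>. Absolute deviations are averaged because, unlike the mere
  convergence of the averages, this notion is stable under products.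
\<close>

definition conv_in_mean :: "nat \<Rightarrow> (nat \<Rightarrow> nat \<Rightarrow> real) \<Rightarrow> real \<Rightarrow> bool" where
  "conv_in_mean m x c \<longleftrightarrow> (\<lambda>n. (\<Sum>i<n + 1 - m. \<bar>x n i - c\<bar>) / real n) \<longlonglongrightarrow> 0"

text \<open>
  Every rough step spoils at most \<open>m\<close> windows, on which the deviation is at most \<open>1\<close>. On any other
  window the logarithms of the weights differ by at most \<open>m * e\<close>.
\<close>

lemma conv_in_mean_luce_p:
  fixes \<theta> :: "nat \<Rightarrow> nat \<Rightarrow> real"
  assumes theta_pos: "\<And>n i. n \<ge> 1 \<Longrightarrow> i \<in> {1..n} \<Longrightarrow> \<theta> n i > 0"
    and rough: "\<And>e. e > 0 \<Longrightarrow> (\<lambda>n. real (card (rough (\<theta> n) n e)) / real n) \<longlonglongrightarrow> 0"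
    and m: "m \<ge> 1" and g: "\<And>j. j \<in> {1..m} \<Longrightarrow> g j \<in> {1..m}"
  shows "conv_in_mean m (\<lambda>n i. luce_p m (\<lambda>j. \<theta> n (i + g j))) (1 / fact m)"
proof -
  let ?p = "\<lambda>n i. luce_p m (\<lambda>j. \<theta> n (i + g j))"
  have bound: "(\<Sum>i<n + 1 - m. \<bar>?p n i - 1 / fact m\<bar>) / real n
     \<le> real m * (real (card (rough (\<theta> n) n e)) / real n) + (exp (real m * (real m * e)) - 1)"
    if e: "e > 0" and n: "n \<ge> 1" for e n
  proof -
    let ?R = "rough (\<theta> n) n e"
    define B where "B = {i \<in> {..<n + 1 - m}. {i + 1..<i + m} \<inter> ?R \<noteq> {}}"
    have fR: "finite ?R" by (simp add: rough_def)
    let ?c = "exp (real m * (real m * e)) - 1"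
    have c: "?c \<ge> 0" using e by simp
    have pos: "\<theta> n (i + g j) > 0" if "i < n + 1 - m" "j \<in> {1..m}" for i j
      using that g[of j] n by (intro theta_pos) auto
    have bad: "\<bar>?p n i - 1 / fact m\<bar> \<le> 1" if "i < n + 1 - m" for i
    proof -
      have "0 \<le> ?p n i" "?p n i \<le> 1" using pos that by (auto intro!: luce_p_bounds)
      moreover have "0 \<le> 1 / (fact m :: real)" "1 / (fact m :: real) \<le> 1" by simp_all
      ultimately show ?thesis by linarith
    qed
    have good: "\<bar>?p n i - 1 / fact m\<bar> \<le> ?c" if i: "i < n + 1 - m" "i \<notin> B" for i
    proof (rule luce_p_near_uniform)
      have drift: "\<bar>ln (\<theta> n (i + b)) - ln (\<theta> n (i + a))\<bar> \<le> real m * e"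
        if ab: "a \<in> {1..m}" "b \<in> {1..m}" "a \<le> b" for a b
      proof -
        have "\<bar>ln (\<theta> n ((i + a) + (b - a))) - ln (\<theta> n (i + a))\<bar> \<le> real (b - a) * e"
        proof (rule ln_drift_le)
          show "{i + a..<i + a + (b - a)} \<subseteq> {1..<n}" using ab i by auto
          have "{i + a..<i + a + (b - a)} \<subseteq> {i + 1..<i + m}" using ab by auto
          moreover have "{i + 1..<i + m} \<inter> ?R = {}" using i by (simp add: B_def)
          ultimately show "{i + a..<i + a + (b - a)} \<inter> ?R = {}" by blast
        qed
        also have "\<dots> \<le> real m * e" using e ab by (intro mult_right_mono) auto
        finally show ?thesis using ab by simp
      qed
      fix a b assume ab: "a \<in> {1..m}" "b \<in> {1..m}"
      have "\<bar>ln (\<theta> n (i + g a)) - ln (\<theta> n (i + g b))\<bar> \<le> real m * e"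
        using drift[OF g[OF ab(1)] g[OF ab(2)]] drift[OF g[OF ab(2)] g[OF ab(1)]]
        by (cases "g a \<le> g b") (auto simp: abs_minus_commute)
      then have "ln (\<theta> n (i + g a)) \<le> real m * e + ln (\<theta> n (i + g b))" by linarith
      then have "exp (ln (\<theta> n (i + g a))) \<le> exp (real m * e + ln (\<theta> n (i + g b)))" by simp
      then show "\<theta> n (i + g a) \<le> exp (real m * e) * \<theta> n (i + g b)"
        using pos[OF i(1) ab(1)] pos[OF i(1) ab(2)] by (simp add: exp_add)
    qed (use pos i e in auto)
    have fB: "finite B" by (simp add: B_def)
    have "B \<subseteq> (\<Union>a\<in>{1..m}. (\<lambda>r. r - a) ` ?R)"
    proof
      fix i assume "i \<in> B"
      then obtain r where r: "r \<in> {i + 1..<i + m}" "r \<in> ?R" unfolding B_def by blast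
      then have "i = r - (r - i)" "r - i \<in> {1..m}" by auto
      then show "i \<in> (\<Union>a\<in>{1..m}. (\<lambda>r. r - a) ` ?R)" using r by blast
    qed
    then have "card B \<le> card (\<Union>a\<in>{1..m}. (\<lambda>r. r - a) ` ?R)"
      using fR by (intro card_mono) auto
    also have "\<dots> \<le> (\<Sum>a\<in>{1..m}. card ((\<lambda>r. r - a) ` ?R))" by (intro card_UN_le) auto
    also have "\<dots> \<le> (\<Sum>a\<in>{1..m}. card ?R)" by (intro sum_mono card_image_le fR)
    finally have cB: "card B \<le> m * card ?R" by simp
    have "(\<Sum>i<n + 1 - m. \<bar>?p n i - 1 / fact m\<bar>) \<le> (\<Sum>i<n + 1 - m. (if i \<in> B then 1 else 0) + ?c)"
    proof (rule sum_mono)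
      fix i assume "i \<in> {..<n + 1 - m}"
      then show "\<bar>?p n i - 1 / fact m\<bar> \<le> (if i \<in> B then 1 else 0) + ?c"
        using bad[of i] good[of i] c unfolding lessThan_iff by (smt (verit))
    qed
    also have "\<dots> = (\<Sum>i<n + 1 - m. if i \<in> B then 1 else 0) + real (n + 1 - m) * ?c"
      by (simp add: sum.distrib)
    also have "(\<Sum>i<n + 1 - m. if i \<in> B then 1 else 0 :: real) = real (card B)"
    proof -
      have "{..<n + 1 - m} \<inter> B = B" by (auto simp: B_def)
      then show ?thesis by (simp add: sum.If_cases)
    qed
    also have "real (card B) + real (n + 1 - m) * ?c \<le> real m * real (card ?R) + real n * ?c"
    proof (rule add_mono)
      show "real (card B) \<le> real m * real (card ?R)" using cB by (metis of_nat_le_iff of_nat_mult)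
      show "real (n + 1 - m) * ?c \<le> real n * ?c" using m c by (intro mult_right_mono) auto
    qed
    finally have "(\<Sum>i<n + 1 - m. \<bar>?p n i - 1 / fact m\<bar>) / real n
       \<le> (real m * real (card ?R) + real n * ?c) / real n" by (rule divide_right_mono) simp
    also have "\<dots> = real m * (real (card ?R) / real n) + ?c" using n by (simp add: add_divide_distrib)
    finally show ?thesis .
  qed
  show ?thesis unfolding conv_in_mean_def
  proof (rule tendstoI)
    fix r :: real assume r: "r > 0"
    \<comment> \<open>Chosen such that the bound for the windows without rough steps equals r / 2.\<close>
    define e where "e = ln (1 + r / 2) / (real m * real m)"
    have e: "e > 0" using r m by (simp add: e_def)
    have ex: "exp (real m * (real m * e)) - 1 = r / 2" using r m by (simp add: e_def)
    have lim: "(\<lambda>n. real m * (real (card (rough (\<theta> n) n e)) / real n)) \<longlonglongrightarrow> real m * 0"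
      using rough[OF e] by (intro tendsto_mult tendsto_const)
    have "eventually (\<lambda>n. real m * (real (card (rough (\<theta> n) n e)) / real n) < r / 2) sequentially"
      using r by (intro order_tendstoD(2)[OF lim]) simp
    with eventually_ge_at_top[of 1]
    show "eventually (\<lambda>n. dist ((\<Sum>i<n + 1 - m. \<bar>?p n i - 1 / fact m\<bar>) / real n) 0 < r) sequentially"
    proof eventually_elim
      case (elim n)
      have "0 \<le> (\<Sum>i<n + 1 - m. \<bar>?p n i - 1 / fact m\<bar>) / real n" by (simp add: sum_nonneg)
      moreover have "(\<Sum>i<n + 1 - m. \<bar>?p n i - 1 / fact m\<bar>) / real n < r"
        using bound[OF e elim(1)] elim(2) ex by linarith
      ultimately show ?case by (simp only: dist_real_def diff_0_right abs_of_nonneg)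
    qed
  qed
qed

lemma conv_in_mean_imp_mean:
  assumes "conv_in_mean m x c"
  shows "(\<lambda>n. (\<Sum>i<n + 1 - m. x n i) / real n) \<longlonglongrightarrow> c"
proof -
  have "(\<lambda>n. (\<Sum>i<n + 1 - m. x n i - c) / real n) \<longlonglongrightarrow> 0"
  proof (rule Lim_null_comparison)
    show "eventually (\<lambda>n. norm ((\<Sum>i<n + 1 - m. x n i - c) / real n) \<le> (\<Sum>i<n + 1 - m. \<bar>x n i - c\<bar>) / real n) sequentially"
      by (intro always_eventually allI) (simp add: divide_right_mono)
    show "(\<lambda>n. (\<Sum>i<n + 1 - m. \<bar>x n i - c\<bar>) / real n) \<longlonglongrightarrow> 0"
      using assms by (simp add: conv_in_mean_def)
  qed
  moreover have "(\<lambda>n. c * (real (n + 1 - m) / real n)) \<longlonglongrightarrow> c * 1"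
  proof (intro tendsto_mult tendsto_const)
    have "(\<lambda>n. 1 + (1 - real m) / real n) \<longlonglongrightarrow> 1 + 0"
      by (intro tendsto_add tendsto_const) real_asymp
    moreover have "eventually (\<lambda>n. 1 + (1 - real m) / real n = real (n + 1 - m) / real n) sequentially"
      using eventually_ge_at_top[of "m + 1"]
      by eventually_elim (auto simp: of_nat_diff field_simps)
    ultimately show "(\<lambda>n. real (n + 1 - m) / real n) \<longlonglongrightarrow> 1"
      by (simp add: tendsto_cong)
  qed
  ultimately have "(\<lambda>n. (\<Sum>i<n + 1 - m. x n i - c) / real n + c * (real (n + 1 - m) / real n)) \<longlonglongrightarrow> 0 + c * 1"
    by (rule tendsto_add)
  moreover have "(\<Sum>i<n + 1 - m. x n i - c) / real n + c * (real (n + 1 - m) / real n) =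
      (\<Sum>i<n + 1 - m. x n i) / real n" for n
    by (simp add: sum_subtractf diff_divide_distrib)
  ultimately show ?thesis by simp
qed

lemma conv_in_mean_le:
  assumes "(\<lambda>n. b n / real n) \<longlonglongrightarrow> 0" "\<And>n. n \<ge> 1 \<Longrightarrow> (\<Sum>i<n + 1 - m. \<bar>x n i - c\<bar>) \<le> b n"
  shows "conv_in_mean m x c"
  unfolding conv_in_mean_def
proof (rule Lim_null_comparison[OF _ assms(1)])
  show "eventually (\<lambda>n. norm ((\<Sum>i<n + 1 - m. \<bar>x n i - c\<bar>) / real n) \<le> b n / real n) sequentially"
    using eventually_ge_at_top[of 1]
    by eventually_elim (use assms(2) in \<open>simp add: sum_nonneg divide_right_mono\<close>)
qed

lemma conv_in_mean_mono:
  assumes "conv_in_mean m x c" "m \<le> m'"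
  shows "conv_in_mean m' x c"
proof (rule conv_in_mean_le)
  show "(\<lambda>n. (\<Sum>i<n + 1 - m. \<bar>x n i - c\<bar>) / real n) \<longlonglongrightarrow> 0"
    using assms(1) by (simp add: conv_in_mean_def)
  show "(\<Sum>i<n + 1 - m'. \<bar>x n i - c\<bar>) \<le> (\<Sum>i<n + 1 - m. \<bar>x n i - c\<bar>)" for n
    using assms(2) by (intro sum_mono2) auto
qed

lemma conv_in_mean_shift:
  assumes "conv_in_mean m x c"
  shows "conv_in_mean (m + h) (\<lambda>n i. x n (i + h)) c"
proof (rule conv_in_mean_le)
  show "(\<lambda>n. (\<Sum>i<n + 1 - m. \<bar>x n i - c\<bar>) / real n) \<longlonglongrightarrow> 0"
    using assms(1) by (simp add: conv_in_mean_def)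
  show "(\<Sum>i<n + 1 - (m + h). \<bar>x n (i + h) - c\<bar>) \<le> (\<Sum>i<n + 1 - m. \<bar>x n i - c\<bar>)" for n
  proof -
    have "(\<Sum>i<n + 1 - (m + h). \<bar>x n (i + h) - c\<bar>) = (\<Sum>i\<in>(\<lambda>i. i + h) ` {..<n + 1 - (m + h)}. \<bar>x n i - c\<bar>)"
      by (subst sum.reindex) auto
    also have "\<dots> \<le> (\<Sum>i<n + 1 - m. \<bar>x n i - c\<bar>)" by (intro sum_mono2) auto
    finally show ?thesis .
  qed
qed

lemma conv_in_mean_sum:
  assumes "finite T" "\<And>t. t \<in> T \<Longrightarrow> conv_in_mean m (x t) (c t)"
  shows "conv_in_mean m (\<lambda>n i. \<Sum>t\<in>T. x t n i) (\<Sum>t\<in>T. c t)"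
proof (rule conv_in_mean_le)
  have "(\<lambda>n. \<Sum>t\<in>T. (\<Sum>i<n + 1 - m. \<bar>x t n i - c t\<bar>) / real n) \<longlonglongrightarrow> (\<Sum>t\<in>T. 0)"
    using assms(2) by (intro tendsto_sum) (auto simp: conv_in_mean_def)
  then show "(\<lambda>n. (\<Sum>t\<in>T. \<Sum>i<n + 1 - m. \<bar>x t n i - c t\<bar>) / real n) \<longlonglongrightarrow> 0"
    by (simp add: sum_divide_distrib)
  show "(\<Sum>i<n + 1 - m. \<bar>(\<Sum>t\<in>T. x t n i) - (\<Sum>t\<in>T. c t)\<bar>) \<le> (\<Sum>t\<in>T. \<Sum>i<n + 1 - m. \<bar>x t n i - c t\<bar>)" for n
    by (subst sum.swap) (auto intro!: sum_mono sum_abs simp: sum_subtractf[symmetric])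
qed

lemma conv_in_mean_mult:
  assumes "conv_in_mean m x c" "conv_in_mean m y d"
    and b: "\<And>n i. n \<ge> 1 \<Longrightarrow> i < n + 1 - m \<Longrightarrow> \<bar>x n i\<bar> \<le> 1" "\<bar>d\<bar> \<le> 1"
  shows "conv_in_mean m (\<lambda>n i. x n i * y n i) (c * d)"
proof (rule conv_in_mean_le)
  have "(\<lambda>n. (\<Sum>i<n + 1 - m. \<bar>x n i - c\<bar>) / real n + (\<Sum>i<n + 1 - m. \<bar>y n i - d\<bar>) / real n) \<longlonglongrightarrow> 0 + 0"
    using assms(1,2) by (intro tendsto_add) (auto simp: conv_in_mean_def)
  then show "(\<lambda>n. (\<Sum>i<n + 1 - m. \<bar>x n i - c\<bar> + \<bar>y n i - d\<bar>) / real n) \<longlonglongrightarrow> 0"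
    by (simp add: sum.distrib add_divide_distrib)
  fix n :: nat assume n: "n \<ge> 1"
  show "(\<Sum>i<n + 1 - m. \<bar>x n i * y n i - c * d\<bar>) \<le> (\<Sum>i<n + 1 - m. \<bar>x n i - c\<bar> + \<bar>y n i - d\<bar>)"
  proof (rule sum_mono)
    fix i assume "i \<in> {..<n + 1 - m}"
    then have bx: "\<bar>x n i\<bar> \<le> 1" using b(1)[OF n] by auto
    have "x n i * y n i - c * d = x n i * (y n i - d) + d * (x n i - c)" by algebra
    then have "\<bar>x n i * y n i - c * d\<bar> \<le> \<bar>x n i\<bar> * \<bar>y n i - d\<bar> + \<bar>d\<bar> * \<bar>x n i - c\<bar>"
      by (metis abs_mult abs_triangle_ineq)
    also have "\<dots> \<le> 1 * \<bar>y n i - d\<bar> + 1 * \<bar>x n i - c\<bar>"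
      using bx b(2) by (intro add_mono mult_right_mono) auto
    finally show "\<bar>x n i * y n i - c * d\<bar> \<le> \<bar>x n i - c\<bar> + \<bar>y n i - d\<bar>" by simp
  qed
qed

section \<open>The variance of the number of occurrences\<close>

text \<open>
  For \<open>k \<ge> 1\<close> an interval of \<open>k\<close> integers determines its starting point; for \<open>k = 0\<close> all the empty
  intervals would coincide.
\<close>

lemma c_occ_eq_sum:
  assumes k: "k \<ge> 1"
  shows "real (c_occ k \<pi> n \<sigma>) = (\<Sum>i<n + 1 - k. of_bool (pat {i + 1..i + k} \<sigma> = \<pi>))"
proof -
  let ?A = "{i \<in> {..<n + 1 - k}. pat {i + 1..i + k} \<sigma> = \<pi>}"
  have "{I. I \<subseteq> {1..n} \<and> card I = k \<and> (\<exists>a b. I = {a..b}) \<and> pat I \<sigma> = \<pi>} = (\<lambda>i. {i + 1..i + k}) ` ?A"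
  proof (intro equalityI subsetI)
    fix I assume "I \<in> {I. I \<subseteq> {1..n} \<and> card I = k \<and> (\<exists>a b. I = {a..b}) \<and> pat I \<sigma> = \<pi>}"
    then obtain a b where I: "I = {a..b}" "{a..b} \<subseteq> {1..n}" "card {a..b} = k" "pat {a..b} \<sigma> = \<pi>" by blast
    then have ab: "a \<le> b" "a \<ge> 1" "b \<le> n" "b = a - 1 + k" "a = a - 1 + 1" using k by auto
    then have "I = {(a - 1) + 1..(a - 1) + k}" using I(1) by simp
    moreover have "a - 1 \<in> ?A" using ab I(4) by auto
    ultimately show "I \<in> (\<lambda>i. {i + 1..i + k}) ` ?A" by blast
  next
    fix I assume "I \<in> (\<lambda>i. {i + 1..i + k}) ` ?A"
    then show "I \<in> {I. I \<subseteq> {1..n} \<and> card I = k \<and> (\<exists>a b. I = {a..b}) \<and> pat I \<sigma> = \<pi>}" by auto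
  qed
  moreover have "inj_on (\<lambda>i. {i + 1..i + k}) ?A"
    using k by (intro inj_onI) (simp add: Icc_eq_Icc)
  ultimately have "c_occ k \<pi> n \<sigma> = card ?A" by (simp add: c_occ_def card_image)
  then show ?thesis by (simp add: sum_of_bool_eq Int_def)
qed

lemma (in prob_space) variance_sum_of_bool:
  assumes ev: "\<And>i. i < N \<Longrightarrow> {\<omega> \<in> space M. Q i \<omega>} \<in> events"
  shows "variance (\<lambda>\<omega>. \<Sum>i<N. of_bool (Q i \<omega>) :: real) =
    (\<Sum>i<N. \<Sum>j<N. prob {\<omega> \<in> space M. Q i \<omega> \<and> Q j \<omega>} - prob {\<omega> \<in> space M. Q i \<omega>} * prob {\<omega> \<in> space M. Q j \<omega>})"
proof -
  have int: "integrable M (\<lambda>\<omega>. of_bool (R \<omega>) :: real)" and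
    E: "expectation (\<lambda>\<omega>. of_bool (R \<omega>)) = prob {\<omega> \<in> space M. R \<omega>}"
    if R: "{\<omega> \<in> space M. R \<omega>} \<in> events" for R
  proof -
    have eq: "of_bool (R \<omega>) = (indicator {\<omega> \<in> space M. R \<omega>} \<omega> :: real)" if "\<omega> \<in> space M" for \<omega>
      using that by (simp add: indicator_def)
    have "integrable M (indicator {\<omega> \<in> space M. R \<omega>} :: _ \<Rightarrow> real)"
      using R by (simp add: integrable_indicator_iff less_top[symmetric] emeasure_eq_measure)
    then show "integrable M (\<lambda>\<omega>. of_bool (R \<omega>) :: real)"
      by (subst Bochner_Integration.integrable_cong[OF refl eq])
    have "expectation (\<lambda>\<omega>. of_bool (R \<omega>) :: real) = expectation (indicator {\<omega> \<in> space M. R \<omega>})"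
      by (rule Bochner_Integration.integral_cong[OF refl eq])
    also have "\<dots> = prob ({\<omega> \<in> space M. R \<omega>} \<inter> space M)" by (rule Bochner_Integration.integral_indicator)
    also have "{\<omega> \<in> space M. R \<omega>} \<inter> space M = {\<omega> \<in> space M. R \<omega>}" by blast
    finally show "expectation (\<lambda>\<omega>. of_bool (R \<omega>)) = prob {\<omega> \<in> space M. R \<omega>}" .
  qed
  have ev2: "{\<omega> \<in> space M. Q i \<omega> \<and> Q j \<omega>} \<in> events" if "i < N" "j < N" for i j
    using ev that by (intro sets.sets_Collect_conj)
  let ?S = "\<lambda>\<omega>. \<Sum>i<N. of_bool (Q i \<omega>) :: real"
  have sq: "(?S \<omega>)\<^sup>2 = (\<Sum>i<N. \<Sum>j<N. of_bool (Q i \<omega> \<and> Q j \<omega>))" for \<omega>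
    unfolding power2_eq_square sum_product by (intro sum.cong refl) simp
  have var: "variance ?S = expectation (\<lambda>\<omega>. (?S \<omega>)\<^sup>2) - (expectation ?S)\<^sup>2"
  proof (rule variance_eq)
    show "integrable M ?S" by (intro Bochner_Integration.integrable_sum int ev) simp
    show "integrable M (\<lambda>\<omega>. (?S \<omega>)\<^sup>2)"
      unfolding sq by (intro Bochner_Integration.integrable_sum int ev2) simp_all
  qed
  have mean: "expectation ?S = (\<Sum>i<N. prob {\<omega> \<in> space M. Q i \<omega>})"
    by (subst Bochner_Integration.integral_sum) (auto intro!: int E ev sum.cong)
  have second: "expectation (\<lambda>\<omega>. (?S \<omega>)\<^sup>2) = (\<Sum>i<N. \<Sum>j<N. prob {\<omega> \<in> space M. Q i \<omega> \<and> Q j \<omega>})"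
  proof -
    have "expectation (\<lambda>\<omega>. \<Sum>j<N. of_bool (Q i \<omega> \<and> Q j \<omega>)) = (\<Sum>j<N. prob {\<omega> \<in> space M. Q i \<omega> \<and> Q j \<omega>})"
      if "i < N" for i
      using that by (subst Bochner_Integration.integral_sum) (auto intro!: int E ev2 sum.cong simp del: of_bool_conj)
    then show ?thesis
      unfolding sq
      by (subst Bochner_Integration.integral_sum)
         (auto intro!: int ev2 sum.cong Bochner_Integration.integrable_sum simp del: of_bool_conj)
  qed
  show ?thesis
    by (rule trans[OF var]) (simp only: mean second, simp only: power2_eq_square sum_product sum_subtractf)
qed

text \<open>
  Summation of a symmetric band matrix along its diagonals.
\<close>

lemma sum_banded_symmetric:
  fixes c :: "nat \<Rightarrow> nat \<Rightarrow> real"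
  assumes sym: "\<And>i j. c i j = c j i" and band: "\<And>i j. j < N \<Longrightarrow> i + k \<le> j \<Longrightarrow> c i j = 0"
  shows "(\<Sum>i<N. \<Sum>j<N. c i j) = (\<Sum>i<N. c i i) + 2 * (\<Sum>h=1..k-1. \<Sum>i<N-h. c i (i + h))"
  using band
proof (induction N)
  case (Suc N)
  have "(\<Sum>i<N. c i N) = (\<Sum>h\<in>{1..N}. c (N - h) N)"
    by (rule sum.reindex_bij_witness[of _ "\<lambda>h. N - h" "\<lambda>i. N - i"]) auto
  also have "\<dots> = (\<Sum>h\<in>{1..N} \<inter> {1..k-1}. c (N - h) N)"
    using Suc.prems[of N] by (intro sum.mono_neutral_right) auto
  also have "\<dots> = (\<Sum>h\<in>{1..k-1}. if h \<in> {1..N} then c (N - h) N else 0)"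
    by (subst Int_commute, rule sum.inter_restrict) simp
  also have "\<dots> = (\<Sum>h\<in>{1..k-1}. if h \<le> N then c (N - h) N else 0)"
    by (intro sum.cong) auto
  finally have edge: "(\<Sum>i<N. c i N) = (\<Sum>h=1..k-1. if h \<le> N then c (N - h) N else 0)" .
  have inner: "(\<Sum>i<Suc N - h. c i (i + h)) = (\<Sum>i<N - h. c i (i + h)) + (if h \<le> N then c (N - h) N else 0)" for h
    by (cases "h \<le> N") (auto simp: Suc_diff_le)
  have row: "(\<Sum>j<N. c N j) = (\<Sum>i<N. c i N)" by (intro sum.cong refl sym)
  have "(\<Sum>i<Suc N. \<Sum>j<Suc N. c i j) = (\<Sum>i<N. \<Sum>j<N. c i j) + 2 * (\<Sum>i<N. c i N) + c N N"
    by (simp add: sum.distrib row)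
  also have "(\<Sum>i<N. \<Sum>j<N. c i j) = (\<Sum>i<N. c i i) + 2 * (\<Sum>h=1..k-1. \<Sum>i<N-h. c i (i + h))"
    using Suc by simp
  finally show ?case
    unfolding inner sum.distrib edge by (simp add: algebra_simps)
qed simp

text \<open>
  The covariance of the indicators of two windows vanishes when the windows are disjoint, so only the
  \<open>k - 1\<close> diagonals on either side of the main one remain.
\<close>

lemma variance_c_occ:
  assumes X: "luce_distributed M X n w" and pos: "\<And>j. j \<in> {1..n} \<Longrightarrow> w j > 0"
    and k: "k \<ge> 1" and pi: "\<pi> permutes {1..k}"
  defines "p \<equiv> \<lambda>i. luce_p k (\<lambda>j. w (i + inv \<pi> j))"
  shows "prob_space.variance M (\<lambda>\<omega>. real (c_occ k \<pi> n (X \<omega>))) =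
    (\<Sum>i<n + 1 - k. p i - p i * p i)
    + 2 * (\<Sum>h=1..k-1. \<Sum>i<n + 1 - (k + h).
        (\<Sum>\<tau>\<in>overlap_perms k \<pi> h. luce_p (h + k) (\<lambda>j. w (i + inv \<tau> j))) - p i * p (i + h))"
proof -
  interpret prob_space M using X by (simp add: luce_distributed_def)
  define N where "N = n + 1 - k"
  have Nh: "n + 1 - (k + h) = N - h" for h by (simp add: N_def)
  let ?Q = "\<lambda>i \<omega>. pat {i + 1..i + k} (X \<omega>) = \<pi>"
  define c where "c = (\<lambda>i j. prob {\<omega> \<in> space M. ?Q i \<omega> \<and> ?Q j \<omega>}
      - prob {\<omega> \<in> space M. ?Q i \<omega>} * prob {\<omega> \<in> space M. ?Q j \<omega>})"
  have in_range: "i + k \<le> n" if "i < N" for i using that k unfolding N_def by linarith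
  have pr: "prob {\<omega> \<in> space M. ?Q i \<omega>} = p i" if "i < N" for i
    unfolding p_def using prob_pat[OF X pos in_range[OF that] pi] .
  have "variance (\<lambda>\<omega>. real (c_occ k \<pi> n (X \<omega>))) = (\<Sum>i<N. \<Sum>j<N. c i j)"
    unfolding c_occ_eq_sum[OF k] c_def N_def
    by (rule variance_sum_of_bool, rule luce_event[OF X pos])
  also have "\<dots> = (\<Sum>i<N. c i i) + 2 * (\<Sum>h=1..k-1. \<Sum>i<N-h. c i (i + h))"
  proof (rule sum_banded_symmetric)
    show "c i j = c j i" for i j
      unfolding c_def by (simp only: mult.commute conj_commute)
    fix i j assume ij: "j < N" "i + k \<le> j"
    then have i: "i < N" by linarith
    show "c i j = 0"
      using prob_pat_disjoint[OF X pos ij(2) in_range[OF ij(1)] pi pi] pr[OF i] pr[OF ij(1)]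
      unfolding c_def p_def by simp
  qed
  also have "(\<Sum>i<N. c i i) = (\<Sum>i<N. p i - p i * p i)"
  proof (intro sum.cong refl)
    fix i assume "i \<in> {..<N}"
    then have i: "i < N" by simp
    show "c i i = p i - p i * p i" unfolding c_def conj_absorb pr[OF i] ..
  qed
  also have "(\<Sum>h=1..k-1. \<Sum>i<N-h. c i (i + h)) = (\<Sum>h=1..k-1. \<Sum>i<N-h.
        (\<Sum>\<tau>\<in>overlap_perms k \<pi> h. luce_p (h + k) (\<lambda>j. w (i + inv \<tau> j))) - p i * p (i + h))"
  proof (intro sum.cong refl)
    fix h i assume "i \<in> {..<N - h}"
    then have i: "i < N" "i + h < N" by auto
    have "i + h + k \<le> n" using in_range[OF i(2)] .
    from prob_pat_overlap[OF X pos this pi]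
    show "c i (i + h) = (\<Sum>\<tau>\<in>overlap_perms k \<pi> h. luce_p (h + k) (\<lambda>j. w (i + inv \<tau> j))) - p i * p (i + h)"
      unfolding c_def pr[OF i(1)] pr[OF i(2)] by simp
  qed
  finally show ?thesis by (simp only: Nh N_def [symmetric])
qed

theorem theorem3p3:
  fixes \<theta> :: "nat \<Rightarrow> nat \<Rightarrow> real"
    and f :: "real \<Rightarrow> real"
    and M :: "nat \<Rightarrow> 'w measure"
    and \<sigma> :: "nat \<Rightarrow> 'w \<Rightarrow> nat \<Rightarrow> nat"
    and k :: nat
    and \<pi> :: "nat \<Rightarrow> nat"
  assumes theta_pos: "\<And>n i. n \<ge> 1 \<Longrightarrow> i \<in> {1..n} \<Longrightarrow> \<theta> n i > 0"
    and f_meas: "f \<in> borel_measurable (lebesgue_on {0..1})"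
    and f_pos: "\<And>y. y \<in> {0..1} \<Longrightarrow> f y > 0"
    and conv: "AE y in lebesgue_on {0..1}. (\<lambda>n. step_fun n (\<theta> n) y) \<longlonglongrightarrow> f y"
    and luce: "\<And>n. n \<ge> 1 \<Longrightarrow> luce_distributed (M n) (\<sigma> n) n (\<theta> n)"
    and k: "k \<ge> 1"
    and pi: "\<pi> permutes {1..k}"
  shows "(\<lambda>n. (1 / real n) * (\<Sum>i<n + 1 - k. luce_p k (\<lambda>j. \<theta> n (i + inv \<pi> j))))
           \<longlonglongrightarrow> 1 / fact k
       \<and> (\<lambda>n. prob_space.variance (M n) (\<lambda>\<omega>. real (c_occ k \<pi> n (\<sigma> n \<omega>))) / real n)
           \<longlonglongrightarrow> nu_inf k \<pi>"
proof -
  have window: "conv_in_mean m (\<lambda>n i. luce_p m (\<lambda>j. \<theta> n (i + inv \<tau> j))) (1 / fact m)"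
    if "m \<ge> 1" "\<tau> permutes {1..m}" for m \<tau>
    using that permutes_in_image[OF permutes_inv[OF that(2)]]
    by (intro conv_in_mean_luce_p[OF theta_pos few_rough_steps[OF theta_pos f_meas f_pos conv]]) auto
  define p where "p = (\<lambda>n i. luce_p k (\<lambda>j. \<theta> n (i + inv \<pi> j)))"
  define q where "q = (\<lambda>h n i. \<Sum>\<tau>\<in>overlap_perms k \<pi> h. luce_p (h + k) (\<lambda>j. \<theta> n (i + inv \<tau> j)))"
  let ?c = "1 / fact k :: real"
  have p: "conv_in_mean k p ?c" unfolding p_def by (rule window[OF k pi])
  have q: "conv_in_mean (k + h) (q h) (zeta_pat \<pi> h k)" for h
  proof -
    have "conv_in_mean (h + k) (q h) (\<Sum>\<tau>\<in>overlap_perms k \<pi> h. 1 / fact (h + k))"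
      unfolding q_def using k
      by (intro conv_in_mean_sum finite_overlap_perms window) (auto simp: overlap_perms_def)
    then show ?thesis by (simp add: zeta_pat_eq_card[OF pi] add.commute)
  qed
  have p_bound: "\<bar>p n i\<bar> \<le> 1" if "n \<ge> 1" "i < n + 1 - k" for n i
  proof -
    have "\<theta> n (i + inv \<pi> j) > 0" if "j \<in> {1..k}" for j
    proof -
      have "inv \<pi> j \<in> {1..k}" using that permutes_in_image[OF permutes_inv[OF pi]] by blast
      then show ?thesis using \<open>n \<ge> 1\<close> \<open>i < n + 1 - k\<close> by (intro theta_pos) auto
    qed
    from luce_p_bounds[of k "\<lambda>j. \<theta> n (i + inv \<pi> j)", OF this] show ?thesis by (simp add: p_def)
  qed
  \<comment> \<open>For \<open>h = 0\<close> this also covers the squares on the main diagonal.\<close>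
  have pp: "conv_in_mean (k + h) (\<lambda>n i. p n i * p n (i + h)) (?c * ?c)" for h
    by (intro conv_in_mean_mult conv_in_mean_mono[OF p] conv_in_mean_shift[OF p] p_bound) auto
  have "(\<lambda>n. (\<Sum>i<n + 1 - k. p n i) / real n - (\<Sum>i<n + 1 - k. p n i * p n i) / real n
      + 2 * (\<Sum>h=1..k-1. (\<Sum>i<n + 1 - (k + h). q h n i) / real n
                         - (\<Sum>i<n + 1 - (k + h). p n i * p n (i + h)) / real n))
    \<longlonglongrightarrow> ?c - ?c * ?c + 2 * (\<Sum>h=1..k-1. zeta_pat \<pi> h k - ?c * ?c)"
    using pp[of 0] by (intro tendsto_intros conv_in_mean_imp_mean p q pp) auto
  moreover have "?c - ?c * ?c + 2 * (\<Sum>h=1..k-1. zeta_pat \<pi> h k - ?c * ?c) = nu_inf k \<pi>"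
  proof -
    have sum: "(\<Sum>h=1..k-1. zeta_pat \<pi> h k - ?c * ?c) = (\<Sum>h=1..k-1. zeta_pat \<pi> h k) - (real k - 1) * (?c * ?c)"
      using k by (simp add: sum_subtractf of_nat_diff)
    have nu: "nu_inf k \<pi> = ?c + (1 - 2 * real k) * (?c * ?c) + 2 * (\<Sum>h=1..k-1. zeta_pat \<pi> h k)"
      by (simp add: nu_inf_def power2_eq_square)
    show ?thesis unfolding sum nu by (simp only: algebra_simps)
  qed
  moreover have "eventually (\<lambda>n. (\<Sum>i<n + 1 - k. p n i) / real n - (\<Sum>i<n + 1 - k. p n i * p n i) / real n
      + 2 * (\<Sum>h=1..k-1. (\<Sum>i<n + 1 - (k + h). q h n i) / real n
                         - (\<Sum>i<n + 1 - (k + h). p n i * p n (i + h)) / real n)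
      = prob_space.variance (M n) (\<lambda>\<omega>. real (c_occ k \<pi> n (\<sigma> n \<omega>))) / real n) sequentially"
    using eventually_ge_at_top[of 1]
  proof eventually_elim
    case (elim n)
    have v: "prob_space.variance (M n) (\<lambda>\<omega>. real (c_occ k \<pi> n (\<sigma> n \<omega>)))
      = (\<Sum>i<n + 1 - k. p n i - p n i * p n i)
      + 2 * (\<Sum>h=1..k-1. \<Sum>i<n + 1 - (k + h). q h n i - p n i * p n (i + h))"
      unfolding p_def q_def by (rule variance_c_occ[OF luce[OF elim] theta_pos[OF elim] k pi])
    show ?case
      by (simp add: v sum_subtractf add_divide_distrib diff_divide_distrib sum_divide_distrib sum_distrib_left)
  qed
  ultimately have "(\<lambda>n. prob_space.variance (M n) (\<lambda>\<omega>. real (c_occ k \<pi> n (\<sigma> n \<omega>))) / real n) \<longlonglongrightarrow> nu_inf k \<pi>"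
    using Lim_transform_eventually by fastforce
  moreover have "(\<lambda>n. (1 / real n) * (\<Sum>i<n + 1 - k. p n i)) \<longlonglongrightarrow> ?c"
    using conv_in_mean_imp_mean[OF p] by simp
  ultimately show ?thesis unfolding p_def by blast
qed

end
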